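(* For each $n\ge1$ let $\pi$ be a uniformly random permutation in $S_n$, and let $\rho$ be a random permutation in $S_n$, independent of $\pi$, with any distribution. Let $V_n=V_n(\pi,\rho)$. (i) $$\mathbb{E}[V_n]=\sum_{k=1}^n\binom nk^2\frac{(n-k)!}{n!},\qquad\text{and}\qquad\mathbb{E}[V_n]\sim\frac{1}{2\sqrt{\pi e}\,n^{1/4}}e^{2n^{1/2}}\quad\text{as }n\to\infty$$ (in the last formula $\pi$ denotes the number $3.14159\ldots$). (ii) $$\mathrm{Var}(V_n)=\sum_{\substack{k,l\ge0\\ k+l\le n}}4^l\frac{1}{(k+l)!}\binom{n}{k+l}\binom{(k+1)/2+l-1}{l}-\left(\sum_{k=1}^n\binom nk^2\frac{(n-k)!}{n!}\right)^2.$$ Furthermore, $$\mathrm{Var}(V_n)\sim\frac{C}{n^{1/4}}e^{2\sqrt{2+\sqrt5}\,n^{1/2}}\qquad\text{as }n\to\infty,$$ where $C$ is a constant. (iii) In particular, $$\frac{V_n-\mathbb{E}[V_n]}{\sqrt{\mathrm{Var}(V_n)}}\longrightarrow0\quad\text{in probability as }n\to\infty.$$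
   Context: For permutations $\pi,\rho\in S_n$ (the symmetric group on $\{1,\ldots,n\}$), $$V_n(\pi,\rho)=\sum_{k=1}^n\ \sum_{1\le i_1<\cdots<i_k\le n}\ \sum_{1\le j_1<\cdots<j_k\le n}\mathbf{1}(\pi(i_1)=\rho(j_1),\ldots,\pi(i_k)=\rho(j_k)).$$ For real $x$ and integer $m\ge0$, $\binom{x}{m}=x(x-1)\cdots(x-m+1)/m!$. $a_n\sim b_n$ means $a_n/b_n\to1$.
   Formalization: In the variance formula of (ii) the subtracted squared sum starts at k=0 instead of k=1; as printed the identity is false (for n=1 the variance is 0, but the printed right side is 4−1=3). *)

theory Defs
  imports
    "HOL-Probability.Probability"
    "HOL-Combinatorics.Permutations"
    "HOL-Library.Landau_Symbols"
begin

text \<open>Index tuples \<open>1 \<le> i\<^sub>1 < \<dots> < i\<^sub>k \<le> n\<close> are strictly increasing lists; the list entry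
  \<open>is ! t\<close> is the mathematical \<open>i\<close> with index \<open>t + 1\<close>.\<close>

definition index_tuples :: "nat \<Rightarrow> nat \<Rightarrow> nat list set" where
  "index_tuples n k = {is. length is = k \<and> set is \<subseteq> {1..n} \<and> sorted_wrt (<) is}"

text \<open>The sum starts at \<open>k = 1\<close>, so the empty common subsequence is not counted by \<open>V n\<close>.
  The sum over \<open>k, l \<ge> 0\<close> in the variance formula of the theorem is the second moment of \<open>V n + 1\<close>,
  which does count it. The square subtracted from that sum therefore has to be the squared
  mean of \<open>V n + 1\<close>, i.e. the square of the sum starting at \<open>k = 0\<close>. Starting the
  subtracted sum at \<open>k = 1\<close> would give \<open>3\<close> instead of \<open>0\<close> for \<open>n = 1\<close>.\<close>

definition V :: "nat \<Rightarrow> (nat \<Rightarrow> nat) \<Rightarrow> (nat \<Rightarrow> nat) \<Rightarrow> nat" where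
  "V n p r = (\<Sum>k = 1..n. \<Sum>is\<in>index_tuples n k. \<Sum>js\<in>index_tuples n k.
     of_bool (\<forall>t<k. p (is ! t) = r (js ! t)))"

abbreviation perm_space :: "nat \<Rightarrow> (nat \<Rightarrow> nat) measure" where
  "perm_space n \<equiv> count_space {p. p permutes {1..n}}"

text \<open>Measurability of both random permutations is part of \<open>prob_space.indep_var\<close>;
  the distribution of the second one is unrestricted.\<close>

definition uniform_indep_perms ::
    "nat \<Rightarrow> 'a measure \<Rightarrow> ('a \<Rightarrow> nat \<Rightarrow> nat) \<Rightarrow> ('a \<Rightarrow> nat \<Rightarrow> nat) \<Rightarrow> bool" where
  "uniform_indep_perms n M P R \<longleftrightarrow>
     prob_space M \<and>
     distr M (perm_space n) P = uniform_count_measure {p. p permutes {1..n}} \<and>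
     prob_space.indep_var M (perm_space n) P (perm_space n) R"

text \<open>The random variables may live on different probability spaces.\<close>

definition tendsto_zero_in_probability :: "(nat \<Rightarrow> 'a measure) \<Rightarrow> (nat \<Rightarrow> 'a \<Rightarrow> real) \<Rightarrow> bool" where
  "tendsto_zero_in_probability M X \<longleftrightarrow>
     (\<forall>\<epsilon>>0. (\<lambda>n. measure (M n) {\<omega> \<in> space (M n). \<bar>X n \<omega>\<bar> > \<epsilon>}) \<longlonglongrightarrow> 0)"

end

theory Submission
  imports Defs
begin

text \<open>
  Fix \<open>\<rho>\<close> and put \<open>\<sigma> = inv \<rho> \<circ> \<pi>\<close>. A common subsequence of \<open>\<pi>\<close> and \<open>\<rho>\<close> is determined by its
  positions in \<open>\<pi>\<close>, and a set \<open>A\<close> of positions gives one exactly when \<open>\<sigma>\<close> is increasing on \<open>A\<close>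
  (\<open>Suc_V_eq_card_increasing_sets\<close>). Hence \<open>V + 1\<close> is the number \<open>Z\<close> of such sets, the empty one
  included. Since \<open>\<pi>\<close> is uniform and independent of \<open>\<rho>\<close>, \<open>\<sigma>\<close> is uniform whatever the law of \<open>\<rho>\<close>, so
  every moment of \<open>V\<close> is an average over \<open>S\<^sub>n\<close> (\<open>uniform_indep_perms_expectation\<close>).

  The second moment of \<open>Z\<close> counts triples \<open>(\<sigma>, A, B)\<close> with \<open>\<sigma>\<close> increasing on \<open>A\<close> and on \<open>B\<close>. Label each
  position by its membership in \<open>A\<close> and \<open>B\<close>, and each value by its membership in \<open>\<sigma> ` A\<close> and
  \<open>\<sigma> ` B\<close>. This gives two words of length \<open>n\<close>. They come from some \<open>\<sigma>\<close> exactly when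
  their subwords of letters in the first set agree and their subwords of letters in the second set
  agree (\<open>order_fibre_nonempty_iff\<close>), and then \<open>\<sigma>\<close> is determined on \<open>A \<union> B\<close> and arbitrary elsewhere. So \<open>E Z\<^sup>2 = \<Sum>m. (n choose m) N(m) / m!\<close>, where \<open>N(m)\<close> counts such
  pairs of words of length \<open>m\<close> without blanks. Cutting both words at their first common letter gives
  the renewal equation \<open>N(m) = d(m) + \<Sum>s<m. d(s) N(m - 1 - s)\<close> with \<open>d(s) = (2s choose s)\<close>
  (\<open>compatible_pairs_renewal\<close>). As \<open>d\<close> has generating function \<open>D = 1 / sqrt (1 - 4X)\<close>, that of \<open>N\<close> is
  \<open>D / (1 - X D) = \<Sum>k. X ^ k * D ^ (k + 1)\<close>, whose coefficients give the double sum in the variance formula.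
  It also equals \<open>(sqrt (1 - 4X) + X) / (1 - 4X - X\<^sup>2)\<close>, whose dominant pole is at \<open>sqrt 5 - 2\<close>, so that
  \<open>N(m)\<close> is asymptotic to a multiple of \<open>\<lambda>\<^sup>m\<close> with \<open>\<lambda> = 2 + sqrt 5\<close> (\<open>renewal_growth\<close>).

  Both moments are thereby reduced to the Laguerre sums \<open>S\<^sub>n(x) = \<Sum>k. (n choose k) x\<^sup>k / k!\<close>:
  \<open>E Z = S\<^sub>n(1)\<close>, while \<open>E Z\<^sup>2\<close> is asymptotic to a multiple of \<open>S\<^sub>n(\<lambda>)\<close>. With \<open>z = sqrt (x n)\<close>, the sum
  \<open>S\<^sub>n(x)\<close> is a sum over the even values \<open>2k\<close> of a Poisson variable of mean \<open>2z\<close>, with weights that are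
  nearly constant near \<open>k = z\<close>, and Chebyshev's inequality yields the asymptotics
  (\<open>laguerre_asymp\<close>). The growth rates are \<open>exp (4 sqrt n)\<close> for \<open>(E Z)\<^sup>2\<close> and
  \<open>exp (2 sqrt \<lambda> sqrt n)\<close> for \<open>E Z\<^sup>2\<close>. Because \<open>\<lambda> > 4\<close>, the squared mean is negligible against the
  variance, and the convergence to \<open>0\<close> in probability is Markov's inequality for the nonnegative
  variable \<open>V\<close>.
\<close>

section \<open>Common subsequences as increasing index sets\<close>

definition increasing_sets :: "nat \<Rightarrow> (nat \<Rightarrow> nat) \<Rightarrow> nat set set" where
  "increasing_sets n \<sigma> = {A. A \<subseteq> {1..n} \<and> strict_mono_on A \<sigma>}"

lemma finite_increasing_sets: "finite (increasing_sets n \<sigma>)"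
  by (rule finite_subset[of _ "Pow {1..n}"]) (auto simp: increasing_sets_def)

lemma bij_betw_index_tuples:
  "bij_betw set (\<Union>k\<in>{1..n}. index_tuples n k) (Pow {1..n} - {{}})"
proof (rule bij_betw_byWitness[where f' = sorted_list_of_set])
  show "\<forall>is\<in>(\<Union>k\<in>{1..n}. index_tuples n k). sorted_list_of_set (set is) = is"
    by (auto simp: index_tuples_def strict_sorted_iff sorted_list_of_set.idem_if_sorted_distinct)
  show "\<forall>A\<in>Pow {1..n} - {{}}. set (sorted_list_of_set A) = A"
    by (auto dest: finite_subset[OF _ finite_atLeastAtMost] simp del: atLeastAtMost_iff)
  show "set ` (\<Union>k\<in>{1..n}. index_tuples n k) \<subseteq> Pow {1..n} - {{}}"
    by (auto simp: index_tuples_def)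
  show "sorted_list_of_set ` (Pow {1..n} - {{}}) \<subseteq> (\<Union>k\<in>{1..n}. index_tuples n k)"
  proof
    fix xs assume "xs \<in> sorted_list_of_set ` (Pow {1..n} - {{}})"
    then obtain A where A: "xs = sorted_list_of_set A" "A \<subseteq> {1..n}" "A \<noteq> {}" by auto
    have fin: "finite A" using A(2) by (rule finite_subset) simp
    have "card A \<le> n" using card_mono[OF _ A(2)] by simp
    moreover have "card A \<ge> 1" using A(3) fin by (simp add: Suc_le_eq card_gt_0_iff)
    moreover have "xs \<in> index_tuples n (card A)"
      using A fin by (simp add: index_tuples_def)
    ultimately show "xs \<in> (\<Union>k\<in>{1..n}. index_tuples n k)" by auto
  qed
qed

lemma finite_index_tuples: "finite (index_tuples n k)"
  by (rule finite_subset[OF _ finite_lists_length_eq[of "{1..n}" k]]) (auto simp: index_tuples_def)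

text \<open>
  Since \<open>r\<close> is injective, the list \<open>js\<close> in the definition of \<open>V\<close> can only be the image of \<open>is\<close>
  under \<open>inv r \<circ> p\<close>, and this list is an admissible index tuple exactly when \<open>inv r \<circ> p\<close> is increasing
  on the entries of \<open>is\<close>. The successor accounts for the empty set.
\<close>
lemma Suc_V_eq_card_increasing_sets:
  assumes p: "p permutes {1..n}" and r: "r permutes {1..n}"
  shows "Suc (V n p r) = card (increasing_sets n (inv r \<circ> p))"
proof -
  define \<sigma> where "\<sigma> = inv r \<circ> p"
  have \<sigma>: "\<sigma> permutes {1..n}"
    unfolding \<sigma>_def using p r by (intro permutes_compose permutes_inv)
  have inner: "(\<Sum>js\<in>index_tuples n k. of_bool (\<forall>t<k. p (is ! t) = r (js ! t))) = (of_bool (strict_mono_on (set is) \<sigma>) :: nat)"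
    if is_in: "is \<in> index_tuples n k" for k "is"
  proof -
    have is_props: "length is = k" "set is \<subseteq> {1..n}" "sorted_wrt (<) is"
      using is_in by (auto simp: index_tuples_def)
    have "p i = r j \<longleftrightarrow> j = \<sigma> i" for i j
      unfolding \<sigma>_def using permutes_inverses[OF r] by auto
    then have ev: "(\<forall>t<k. p (is ! t) = r (js ! t)) \<longleftrightarrow> js = map \<sigma> is" if "js \<in> index_tuples n k" for js
      using that is_props(1) by (auto simp: index_tuples_def list_eq_iff_nth_eq)
    have mem: "map \<sigma> is \<in> index_tuples n k \<longleftrightarrow> strict_mono_on (set is) \<sigma>"
    proof -
      have "sorted_wrt (<) (map \<sigma> is) \<longleftrightarrow> strict_mono_on (set is) \<sigma>"
      proof
        assume s: "sorted_wrt (<) (map \<sigma> is)"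
        show "strict_mono_on (set is) \<sigma>"
        proof (rule strict_mono_onI)
          fix x y assume xy: "x \<in> set is" "y \<in> set is" "x < y"
          then obtain a b where ab: "a < length is" "b < length is" "x = is ! a" "y = is ! b"
            by (auto simp: in_set_conv_nth)
          have "a < b"
          proof (rule ccontr)
            assume "\<not> a < b"
            then have "b < a \<or> a = b" by auto
            then show False using ab xy(3) is_props(3) by (auto simp: sorted_wrt_iff_nth_less dest: less_asym)
          qed
          then show "\<sigma> x < \<sigma> y" using s ab by (auto simp: sorted_wrt_iff_nth_less)
        qed
      next
        assume "strict_mono_on (set is) \<sigma>"
        then show "sorted_wrt (<) (map \<sigma> is)"
          unfolding sorted_wrt_map
          by (intro sorted_wrt_mono_rel[OF _ is_props(3)]) (auto simp: strict_mono_on_def)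
      qed
      moreover have "set (map \<sigma> is) \<subseteq> {1..n}" using is_props(2) permutes_image[OF \<sigma>] by auto
      ultimately show ?thesis using is_props(1) by (simp add: index_tuples_def)
    qed
    have "(\<Sum>js\<in>index_tuples n k. of_bool (\<forall>t<k. p (is ! t) = r (js ! t))) =
        (\<Sum>js\<in>index_tuples n k. if js = map \<sigma> is then 1 else (0 :: nat))"
      by (intro sum.cong refl) (simp add: ev)
    also have "\<dots> = of_bool (strict_mono_on (set is) \<sigma>)"
      using mem by (simp add: finite_index_tuples)
    finally show ?thesis .
  qed
  have "V n p r = (\<Sum>k = 1..n. \<Sum>is\<in>index_tuples n k. of_bool (strict_mono_on (set is) \<sigma>))"
    unfolding V_def by (intro sum.cong refl inner)
  also have "\<dots> = (\<Sum>is\<in>(\<Union>k\<in>{1..n}. index_tuples n k). of_bool (strict_mono_on (set is) \<sigma>))"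
    by (rule sum.UNION_disjoint[symmetric]) (auto simp: finite_index_tuples, auto simp: index_tuples_def)
  also have "\<dots> = (\<Sum>A\<in>Pow {1..n} - {{}}. of_bool (strict_mono_on A \<sigma>))"
    by (rule sum.reindex_bij_betw[OF bij_betw_index_tuples])
  also have "\<dots> = card ((Pow {1..n} - {{}}) \<inter> {A. strict_mono_on A \<sigma>})"
    by (simp add: of_bool_def sum.If_cases)
  also have "(Pow {1..n} - {{}}) \<inter> {A. strict_mono_on A \<sigma>} = increasing_sets n \<sigma> - {{}}"
    by (auto simp: increasing_sets_def)
  finally have "V n p r = card (increasing_sets n \<sigma> - {{}})" .
  moreover have "{} \<in> increasing_sets n \<sigma>" by (simp add: increasing_sets_def)
  ultimately show ?thesis
    using card_Suc_Diff1[OF finite_increasing_sets, of "{}" n \<sigma>] by (simp only: \<sigma>_def)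
qed

section \<open>Permutations increasing on two prescribed sets\<close>

lemma map_sorted_list_of_set_strict_mono:
  fixes f :: "nat \<Rightarrow> nat"
  assumes "finite A" "strict_mono_on A f"
  shows "map f (sorted_list_of_set A) = sorted_list_of_set (f ` A)"
proof (rule strict_sorted_equal)
  show "sorted_wrt (<) (map f (sorted_list_of_set A))"
    unfolding sorted_wrt_map
    by (rule sorted_wrt_mono_rel[OF _ strict_sorted_list_of_set])
      (use assms in \<open>auto simp: strict_mono_on_def\<close>)
qed (use assms in auto)

text \<open>
  An increasing map on a finite set sends the \<open>t\<close>-th smallest element to the \<open>t\<close>-th smallest
  element of its image, so the image determines it.
\<close>
lemma strict_mono_on_eq_if_image_eq:
  fixes f g :: "nat \<Rightarrow> nat"
  assumes "finite A" "strict_mono_on A f" "strict_mono_on A g" "f ` A = g ` A" "x \<in> A"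
  shows "f x = g x"
proof -
  have "map f (sorted_list_of_set A) = map g (sorted_list_of_set A)"
    using assms map_sorted_list_of_set_strict_mono by metis
  then show ?thesis using assms by simp
qed

lemma ex_strict_mono_on_image:
  fixes A A' :: "nat set"
  assumes "finite A" "finite A'" "card A = card A'"
  shows "\<exists>f. strict_mono_on A f \<and> f ` A = A'"
proof -
  obtain h where h: "bij_betw h {..<card A} A" "strict_mono_on {..<card A} h"
    using ex_bij_betw_strict_mono_card[OF assms(1)] by blast
  obtain h' where h': "bij_betw h' {..<card A} A'" "strict_mono_on {..<card A} h'"
    using ex_bij_betw_strict_mono_card[OF assms(2)] assms(3) by metis
  define i where "i = inv_into {..<card A} h"
  have i: "bij_betw i A {..<card A}" unfolding i_def by (rule bij_betw_inv_into[OF h(1)])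
  have "strict_mono_on A i"
  proof (rule strict_mono_onI)
    fix x y assume xy: "x \<in> A" "y \<in> A" "x < y"
    have "h (i x) = x" "h (i y) = y" "i x \<in> {..<card A}" "i y \<in> {..<card A}"
      using xy h(1) bij_betwE[OF i] by (auto simp: i_def bij_betw_inv_into_right)
    then show "i x < i y"
      using h(2) xy(3) by (metis linorder_neqE_nat order_less_asym strict_mono_onD)
  qed
  then have "strict_mono_on A (h' \<circ> i)"
    using h'(2) bij_betwE[OF i] by (simp add: strict_mono_on_def)
  moreover have "(h' \<circ> i) ` A = A'"
    using bij_betw_trans[OF i h'(1)] by (simp add: bij_betw_def)
  ultimately show ?thesis by (intro exI[of _ "h' \<circ> i"] conjI)
qed

lemma ex_permutation_extending:
  assumes "finite S" "U \<subseteq> S" "inj_on g U" "g ` U \<subseteq> S"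
  shows "\<exists>\<tau>. \<tau> permutes S \<and> (\<forall>x\<in>U. \<tau> x = g x)"
proof -
  have fin: "finite U" using assms finite_subset by blast
  have "card (S - U) = card (S - g ` U)"
    using assms fin by (simp add: card_Diff_subset card_image)
  then obtain h where h: "bij_betw h (S - U) (S - g ` U)"
    using assms(1) by (metis bij_betw_iff_card finite_Diff)
  define \<tau> where "\<tau> = (\<lambda>x. if x \<in> S then (if x \<in> U then g x else h x) else x)"
  have "bij_betw \<tau> U (g ` U)"
  proof -
    have "\<forall>x\<in>U. \<tau> x = g x" using assms(2) by (auto simp: \<tau>_def)
    then show ?thesis
      using bij_betw_cong[of U \<tau> g] inj_on_imp_bij_betw[OF assms(3)] by blast
  qed
  moreover have "bij_betw \<tau> (S - U) (S - g ` U)"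
  proof -
    have "\<forall>x\<in>S - U. \<tau> x = h x" by (simp add: \<tau>_def)
    then show ?thesis using bij_betw_cong[of "S - U" \<tau> h] h by blast
  qed
  ultimately have "bij_betw \<tau> (U \<union> (S - U)) (g ` U \<union> (S - g ` U))"
    by (rule bij_betw_combine) auto
  then have "bij_betw \<tau> S S" using assms by (simp add: Un_absorb1)
  then have "\<tau> permutes S" by (rule bij_imp_permutes) (simp add: \<tau>_def)
  moreover have "\<forall>x\<in>U. \<tau> x = g x" using assms(2) by (auto simp: \<tau>_def)
  ultimately show ?thesis by blast
qed

text \<open>
  Composition with \<open>inv \<tau>\<close> turns the permutations that agree with \<open>\<tau>\<close> on \<open>U\<close> into those that fix
  \<open>U\<close> pointwise.
\<close>
lemma card_permutations_agreeing:
  assumes "finite S" "U \<subseteq> S" "\<tau> permutes S"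
  shows "card {\<sigma>. \<sigma> permutes S \<and> (\<forall>x\<in>U. \<sigma> x = \<tau> x)} = fact (card S - card U)"
proof -
  have "{\<sigma>. \<sigma> permutes S \<and> (\<forall>x\<in>U. \<sigma> x = \<tau> x)} = (\<lambda>\<rho>. \<tau> \<circ> \<rho>) ` {\<rho>. \<rho> permutes (S - U)}"
  proof (intro equalityI subsetI)
    fix \<sigma> assume \<sigma>: "\<sigma> \<in> {\<sigma>. \<sigma> permutes S \<and> (\<forall>x\<in>U. \<sigma> x = \<tau> x)}"
    have "(inv \<tau> \<circ> \<sigma>) permutes S"
      using \<sigma> permutes_compose[OF _ permutes_inv[OF assms(3)]] by blast
    moreover have "(inv \<tau> \<circ> \<sigma>) x = x" if "x \<in> S - (S - U)" for x
      using that \<sigma> assms(3) by (simp add: permutes_inverses)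
    ultimately have "(inv \<tau> \<circ> \<sigma>) permutes (S - U)" by (rule permutes_superset)
    moreover have "\<sigma> = \<tau> \<circ> (inv \<tau> \<circ> \<sigma>)"
      using permutes_inv_o(1)[OF assms(3)] by (simp add: o_assoc)
    ultimately show "\<sigma> \<in> (\<lambda>\<rho>. \<tau> \<circ> \<rho>) ` {\<rho>. \<rho> permutes (S - U)}" by blast
  next
    fix \<sigma> assume "\<sigma> \<in> (\<lambda>\<rho>. \<tau> \<circ> \<rho>) ` {\<rho>. \<rho> permutes (S - U)}"
    then obtain \<rho> where \<rho>: "\<rho> permutes (S - U)" "\<sigma> = \<tau> \<circ> \<rho>" by blast
    moreover have "\<rho> permutes S" using \<rho>(1) by (rule permutes_subset) auto
    ultimately show "\<sigma> \<in> {\<sigma>. \<sigma> permutes S \<and> (\<forall>x\<in>U. \<sigma> x = \<tau> x)}"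
      using permutes_compose[OF _ assms(3)] by (auto simp: permutes_not_in)
  qed
  moreover have "inj_on (\<lambda>\<rho>. \<tau> \<circ> \<rho>) {\<rho>. \<rho> permutes (S - U)}"
    using permutes_inj[OF assms(3)] by (intro inj_onI) (simp add: fun.inj_map_strong inj_eq fun_eq_iff)
  ultimately have "card {\<sigma>. \<sigma> permutes S \<and> (\<forall>x\<in>U. \<sigma> x = \<tau> x)} = card {\<rho>. \<rho> permutes (S - U)}"
    by (simp add: card_image)
  also have "\<dots> = fact (card (S - U))"
    using assms by (intro card_permutations) auto
  also have "card (S - U) = card S - card U"
    using assms by (meson card_Diff_subset finite_subset)
  finally show ?thesis .
qed

text \<open>
  The permutations that produce given label words: the sets \<open>A\<close>, \<open>B\<close> label the positions and
  \<open>A'\<close>, \<open>B'\<close> label the values.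
\<close>
definition order_fibre :: "nat \<Rightarrow> nat set \<Rightarrow> nat set \<Rightarrow> nat set \<Rightarrow> nat set \<Rightarrow> (nat \<Rightarrow> nat) set" where
  "order_fibre n A B A' B' = {\<sigma>. \<sigma> permutes {1..n} \<and> strict_mono_on A \<sigma> \<and> strict_mono_on B \<sigma> \<and> \<sigma> ` A = A' \<and> \<sigma> ` B = B'}"

text \<open>
  By uniqueness of increasing maps with given image, all members of a fibre agree on \<open>A \<union> B\<close>, and
  nothing constrains them elsewhere.
\<close>
lemma card_order_fibre:
  assumes "A \<subseteq> {1..n}" "B \<subseteq> {1..n}" "order_fibre n A B A' B' \<noteq> {}"
  shows "card (order_fibre n A B A' B') = fact (n - card (A \<union> B))"
proof -
  obtain \<tau> where \<tau>: "\<tau> \<in> order_fibre n A B A' B'" using assms(3) by auto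
  have fin: "finite A" "finite B"
    using finite_subset[OF assms(1)] finite_subset[OF assms(2)] by simp_all
  have "\<sigma> \<in> order_fibre n A B A' B' \<longleftrightarrow> \<sigma> permutes {1..n} \<and> (\<forall>x\<in>A \<union> B. \<sigma> x = \<tau> x)" for \<sigma>
  proof
    assume \<sigma>: "\<sigma> \<in> order_fibre n A B A' B'"
    have "\<sigma> x = \<tau> x" if "x \<in> A" for x
      by (rule strict_mono_on_eq_if_image_eq[OF fin(1) _ _ _ that]) (use \<sigma> \<tau> in \<open>simp_all add: order_fibre_def\<close>)
    moreover have "\<sigma> x = \<tau> x" if "x \<in> B" for x
      by (rule strict_mono_on_eq_if_image_eq[OF fin(2) _ _ _ that]) (use \<sigma> \<tau> in \<open>simp_all add: order_fibre_def\<close>)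
    ultimately show "\<sigma> permutes {1..n} \<and> (\<forall>x\<in>A \<union> B. \<sigma> x = \<tau> x)"
      using \<sigma> by (simp add: order_fibre_def ball_Un)
  next
    assume \<sigma>: "\<sigma> permutes {1..n} \<and> (\<forall>x\<in>A \<union> B. \<sigma> x = \<tau> x)"
    then have "\<sigma> ` A = \<tau> ` A" "\<sigma> ` B = \<tau> ` B" by (intro image_cong; simp)+
    moreover have "strict_mono_on A \<sigma>" "strict_mono_on B \<sigma>"
      using \<sigma> \<tau> by (simp_all add: order_fibre_def strict_mono_on_def)
    ultimately show "\<sigma> \<in> order_fibre n A B A' B'"
      using \<sigma> \<tau> by (simp add: order_fibre_def)
  qed
  then have "order_fibre n A B A' B' = {\<sigma>. \<sigma> permutes {1..n} \<and> (\<forall>x\<in>A \<union> B. \<sigma> x = \<tau> x)}"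
    by blast
  then show ?thesis
    using card_permutations_agreeing[of "{1..n}" "A \<union> B" \<tau>] \<tau> assms(1,2)
    by (simp add: order_fibre_def)
qed

definition label_word :: "nat \<Rightarrow> nat set \<Rightarrow> nat set \<Rightarrow> (bool \<times> bool) list" where
  "label_word n A B = map (\<lambda>i. (i \<in> A, i \<in> B)) [1..<Suc n]"

text \<open>
  The words represent equal elements of the partially commutative monoid on the letters
  \<open>a = (True, False)\<close>, \<open>b = (False, True)\<close> and \<open>c = (True, True)\<close> in which only \<open>a\<close> and \<open>b\<close> commute;
  the blank \<open>(False, False)\<close> counts as the identity. The criterion is the projection test: the subwords over
  \<open>{a, c}\<close> agree and the subwords over \<open>{b, c}\<close> agree.
\<close>
definition compatible :: "(bool \<times> bool) list \<Rightarrow> (bool \<times> bool) list \<Rightarrow> bool" where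
  "compatible w v \<longleftrightarrow> filter fst w = filter fst v \<and> filter snd w = filter snd v"

lemma filter_mem_upt:
  assumes "A \<subseteq> {1..n}"
  shows "filter (\<lambda>i. i \<in> A) [1..<Suc n] = sorted_list_of_set A"
proof (rule strict_sorted_equal)
  show "sorted_wrt (<) (filter (\<lambda>i. i \<in> A) [1..<Suc n])"
    by (rule sorted_wrt_filter[OF sorted_wrt_upt])
  have "finite A" using assms finite_subset[OF _ finite_atLeastAtMost] by blast
  then show "set (filter (\<lambda>i. i \<in> A) [1..<Suc n]) = set (sorted_list_of_set A)"
    using assms by (auto simp: subset_iff less_Suc_eq_le)
qed simp

lemma filter_label_word:
  assumes "A \<subseteq> {1..n}" "B \<subseteq> {1..n}"
  shows "filter fst (label_word n A B) = map (\<lambda>i. (True, i \<in> B)) (sorted_list_of_set A)"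
    and "filter snd (label_word n A B) = map (\<lambda>i. (i \<in> A, True)) (sorted_list_of_set B)"
proof -
  have "finite A" "finite B"
    using assms(1,2) finite_subset[OF _ finite_atLeastAtMost] by blast+
  then show "filter fst (label_word n A B) = map (\<lambda>i. (True, i \<in> B)) (sorted_list_of_set A)"
    and "filter snd (label_word n A B) = map (\<lambda>i. (i \<in> A, True)) (sorted_list_of_set B)"
    unfolding label_word_def filter_map
    using filter_mem_upt[OF assms(1)] filter_mem_upt[OF assms(2)] by (auto simp: comp_def)
qed

text \<open>
  Equal projections say that the order isomorphism \<open>A \<rightarrow> A'\<close> preserves membership in the second set
  and that the order isomorphism \<open>B \<rightarrow> B'\<close> preserves membership in the first. Both therefore restrict
  to order isomorphisms \<open>A \<inter> B \<rightarrow> A' \<inter> B'\<close>, which are unique, so the two maps glue to an injection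
  on \<open>A \<union> B\<close> that extends to a permutation.
\<close>
lemma order_fibre_nonempty_iff:
  assumes "A \<subseteq> {1..n}" "B \<subseteq> {1..n}" "A' \<subseteq> {1..n}" "B' \<subseteq> {1..n}"
  shows "order_fibre n A B A' B' \<noteq> {} \<longleftrightarrow> compatible (label_word n A B) (label_word n A' B')"
proof
  assume "order_fibre n A B A' B' \<noteq> {}"
  then obtain \<sigma> where \<sigma>: "\<sigma> permutes {1..n}" "strict_mono_on A \<sigma>" "strict_mono_on B \<sigma>"
    "\<sigma> ` A = A'" "\<sigma> ` B = B'" by (auto simp: order_fibre_def)
  have fin: "finite A" "finite B"
    using assms(1,2) finite_subset[OF _ finite_atLeastAtMost] by blast+
  have A': "sorted_list_of_set A' = map \<sigma> (sorted_list_of_set A)"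
    and B': "sorted_list_of_set B' = map \<sigma> (sorted_list_of_set B)"
    using \<sigma> fin by (auto simp: map_sorted_list_of_set_strict_mono)
  have "\<sigma> i \<in> A' \<longleftrightarrow> i \<in> A" "\<sigma> i \<in> B' \<longleftrightarrow> i \<in> B" for i
    unfolding \<sigma>(4,5)[symmetric] by (rule inj_image_mem_iff[OF permutes_inj[OF \<sigma>(1)]])+
  then show "compatible (label_word n A B) (label_word n A' B')"
    unfolding compatible_def filter_label_word[OF assms(1,2)] filter_label_word[OF assms(3,4)] A' B'
    by simp
next
  assume c: "compatible (label_word n A B) (label_word n A' B')"
  have fin: "finite A" "finite B" "finite A'" "finite B'"
    using assms finite_subset[OF _ finite_atLeastAtMost] by blast+
  have cA: "map (\<lambda>i. (True, i \<in> B)) (sorted_list_of_set A) = map (\<lambda>i. (True, i \<in> B')) (sorted_list_of_set A')"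
    and cB: "map (\<lambda>i. (i \<in> A, True)) (sorted_list_of_set B) = map (\<lambda>i. (i \<in> A', True)) (sorted_list_of_set B')"
    using c unfolding compatible_def filter_label_word[OF assms(1,2)] filter_label_word[OF assms(3,4)] by auto
  have "card A = card A'" "card B = card B'"
    using arg_cong[OF cA, of length] arg_cong[OF cB, of length] by auto
  then obtain \<alpha> \<beta> where \<alpha>: "strict_mono_on A \<alpha>" "\<alpha> ` A = A'" and \<beta>: "strict_mono_on B \<beta>" "\<beta> ` B = B'"
    using ex_strict_mono_on_image fin by metis
  have \<alpha>B: "\<alpha> i \<in> B' \<longleftrightarrow> i \<in> B" if "i \<in> A" for i
    using cA that fin unfolding \<alpha>(2)[symmetric] map_sorted_list_of_set_strict_mono[OF fin(1) \<alpha>(1), symmetric]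
    by (simp add: \<alpha>(2))
  have \<beta>A: "\<beta> i \<in> A' \<longleftrightarrow> i \<in> A" if "i \<in> B" for i
    using cB that fin unfolding \<beta>(2)[symmetric] map_sorted_list_of_set_strict_mono[OF fin(2) \<beta>(1), symmetric]
    by (simp add: \<beta>(2))
  have agree: "\<alpha> i = \<beta> i" if "i \<in> A \<inter> B" for i
  proof (rule strict_mono_on_eq_if_image_eq[OF _ _ _ _ that])
    show "strict_mono_on (A \<inter> B) \<alpha>" "strict_mono_on (A \<inter> B) \<beta>"
      using \<alpha> \<beta> by (auto simp: strict_mono_on_def)
    have "\<alpha> ` (A \<inter> B) = A' \<inter> B'" using \<alpha>B \<alpha>(2) by auto
    moreover have "\<beta> ` (A \<inter> B) = A' \<inter> B'" using \<beta>A \<beta>(2) by auto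
    ultimately show "\<alpha> ` (A \<inter> B) = \<beta> ` (A \<inter> B)" by simp
  qed (use fin in auto)
  \<comment> \<open>The two isomorphisms agree on \<open>A \<inter> B\<close>, so preferring \<open>\<alpha>\<close> there is harmless.\<close>
  define g where "g = (\<lambda>i. if i \<in> A then \<alpha> i else \<beta> i)"
  have gA: "g i = \<alpha> i" if "i \<in> A" for i using that by (simp add: g_def)
  have gB: "g i = \<beta> i" if "i \<in> B" for i using that agree by (simp add: g_def)
  have inj: "inj_on g (A \<union> B)"
  proof (rule inj_onI)
    fix x y assume xy: "x \<in> A \<union> B" "y \<in> A \<union> B" "g x = g y"
    have iA: "inj_on \<alpha> A" and iB: "inj_on \<beta> B" using \<alpha> \<beta> strict_mono_on_imp_inj_on by blast+
    have gA': "g i \<in> A' \<longleftrightarrow> i \<in> A" if "i \<in> A \<union> B" for i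
      using that \<alpha>(2) \<beta>A by (auto simp: g_def)
    show "x = y"
    proof (cases "x \<in> A")
      case True
      then have "y \<in> A" using gA' xy by metis
      then show ?thesis using True xy(3) iA by (simp add: gA inj_on_eq_iff)
    next
      case False
      then have "y \<notin> A" using gA' xy by metis
      then show ?thesis using False xy iB by (simp add: g_def inj_on_eq_iff)
    qed
  qed
  have "g ` A = A'" "g ` B = B'" using gA gB \<alpha>(2) \<beta>(2) by (metis image_cong)+
  then have "g ` (A \<union> B) \<subseteq> {1..n}" using assms by (simp add: image_Un)
  then obtain \<tau> where \<tau>: "\<tau> permutes {1..n}" "\<forall>x\<in>A \<union> B. \<tau> x = g x"
    using ex_permutation_extending[of "{1..n}" "A \<union> B" g] inj assms by auto
  have "\<tau> ` A = A'" using \<tau>(2) \<open>g ` A = A'\<close> by (auto simp: image_iff) 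
  moreover have "\<tau> ` B = B'" using \<tau>(2) \<open>g ` B = B'\<close> by (auto simp: image_iff)
  moreover have "strict_mono_on A \<tau>" "strict_mono_on B \<tau>"
    using \<tau>(2) \<alpha>(1) \<beta>(1) by (auto simp: strict_mono_on_def gA gB)
  ultimately show "order_fibre n A B A' B' \<noteq> {}" using \<tau>(1) by (auto simp: order_fibre_def)
qed

section \<open>Pairs of words with equal projections\<close>

text \<open>
  Such a word arises from \<open>u\<close> by choosing which of the \<open>n\<close> places carry the letters of \<open>u\<close>; the
  letter \<open>b\<close> fills the rest.
\<close>
lemma card_words_filter:
  "finite {w. length w = n \<and> filter (\<lambda>x. x \<noteq> b) w = u}"
  "card {w. length w = n \<and> filter (\<lambda>x. x \<noteq> b) w = u} = (if b \<in> set u then 0 else n choose length u)"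
proof -
  have "finite {w. length w = n \<and> filter (\<lambda>x. x \<noteq> b) w = u} \<and>
    card {w. length w = n \<and> filter (\<lambda>x. x \<noteq> b) w = u} = (if b \<in> set u then 0 else n choose length u)"
  proof (induction n arbitrary: u)
    case 0
    have "{w. length w = 0 \<and> filter (\<lambda>x. x \<noteq> b) w = u} = (if u = [] then {[]} else {})" by auto
    then show ?case by (cases u) auto
  next
    case (Suc n)
    define W where "W = (\<lambda>u. {w. length w = n \<and> filter (\<lambda>x. x \<noteq> b) w = u})"
    have W: "finite (W u)" "card (W u) = (if b \<in> set u then 0 else n choose length u)" for u
      using Suc.IH[of u] by (auto simp: W_def)
    show ?case
    proof (cases u)
      case Nil
      have "{w. length w = Suc n \<and> filter (\<lambda>x. x \<noteq> b) w = u} = Cons b ` W []"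
        by (auto simp: W_def Nil length_Suc_conv image_iff split: if_splits)
      then show ?thesis using W[of "[]"] Nil by (simp add: card_image)
    next
      case (Cons x u')
      have eq: "{w. length w = Suc n \<and> filter (\<lambda>x. x \<noteq> b) w = u} =
          Cons b ` W u \<union> (if x = b then {} else Cons x ` W u')"
        by (auto simp: W_def Cons length_Suc_conv image_iff split: if_splits)
      show ?thesis
      proof (cases "x = b")
        case True
        then have "W u = {}" using W[of u] Cons by simp
        then show ?thesis unfolding eq using True Cons by simp
      next
        case False
        then have "card {w. length w = Suc n \<and> filter (\<lambda>x. x \<noteq> b) w = u} = card (W u) + card (W u')"
          unfolding eq using W by (subst card_Un_disjoint) (auto simp: card_image)
        then show ?thesis using W False eq Cons by auto
      qed
    qed
  qed
  then show "finite {w. length w = n \<and> filter (\<lambda>x. x \<noteq> b) w = u}"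
    "card {w. length w = n \<and> filter (\<lambda>x. x \<noteq> b) w = u} = (if b \<in> set u then 0 else n choose length u)"
    by blast+
qed

definition compatible_pairs :: "nat \<Rightarrow> ((bool \<times> bool) list \<times> (bool \<times> bool) list) set" where
  "compatible_pairs m = {(w, v). length w = m \<and> length v = m \<and>
     (False, False) \<notin> set w \<and> (False, False) \<notin> set v \<and> compatible w v}"

lemma finite_words: "finite {w :: (bool \<times> bool) list. length w = n}"
  using finite_lists_length_eq[of "UNIV :: (bool \<times> bool) set" n] by simp

lemma finite_compatible_pairs: "finite (compatible_pairs m)"
  by (rule finite_subset[OF _ finite_cartesian_product[OF finite_words[of m] finite_words[of m]]])
    (auto simp: compatible_pairs_def)

abbreviation nonblank :: "(bool \<times> bool) list \<Rightarrow> (bool \<times> bool) list" where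
  "nonblank w \<equiv> filter (\<lambda>x. x \<noteq> (False, False)) w"

text \<open>
  Inclusion and exclusion for the letters in the first and in the second set. All terms but
  the first depend only on the two projections, so compatible words have equally many letters that
  are not blank.
\<close>
lemma length_nonblank:
  "length (nonblank w) + length (filter snd (filter fst w)) = length (filter fst w) + length (filter snd w)"
  by (induction w) auto

lemma compatible_length_nonblank:
  "compatible w v \<Longrightarrow> length (nonblank w) = length (nonblank v)"
  using length_nonblank[of w] length_nonblank[of v] by (simp add: compatible_def)

lemma compatible_nonblank: "compatible (nonblank w) (nonblank v) \<longleftrightarrow> compatible w v"
proof -
  have "filter fst (nonblank w) = filter fst w \<and> filter snd (nonblank w) = filter snd w" for w
    by (induction w) auto
  then show ?thesis by (simp add: compatible_def)
qed

text \<open>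
  Delete the blanks from both words. What remains is a compatible pair of some length \<open>m\<close>, and the
  blanks can be put back independently in \<open>(n choose m)\<close> ways for each word.
\<close>
lemma sum_compatible_words:
  "(\<Sum>(w, v)\<in>{(w, v). length w = n \<and> length v = n \<and> compatible w v}. fact (n - length (nonblank w))) =
   (\<Sum>m\<le>n. (n choose m)\<^sup>2 * fact (n - m) * card (compatible_pairs m))" (is "sum ?h ?S = _")
proof -
  define \<phi> where "\<phi> = (\<lambda>(w, v). (nonblank w, nonblank v))"
  have finS: "finite ?S"
    by (rule finite_subset[OF _ finite_cartesian_product[OF finite_words[of n] finite_words[of n]]]) auto
  have sub: "\<phi> ` ?S \<subseteq> (\<Union>m\<le>n. compatible_pairs m)"
  proof
    fix y assume "y \<in> \<phi> ` ?S"
    then obtain w v where wv: "length w = n" "length v = n" "compatible w v" "y = (nonblank w, nonblank v)"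
      by (auto simp: \<phi>_def)
    have "length (nonblank w) \<le> n" using wv(1) length_filter_le[of _ w] by metis
    moreover have "y \<in> compatible_pairs (length (nonblank w))"
      using wv compatible_length_nonblank[OF wv(3)]
      by (simp add: compatible_pairs_def compatible_nonblank)
    ultimately show "y \<in> (\<Union>m\<le>n. compatible_pairs m)" by auto
  qed
  have fib: "sum ?h {x \<in> ?S. \<phi> x = y} = (n choose m)\<^sup>2 * fact (n - m)" if "y \<in> compatible_pairs m" for y m
  proof -
    obtain w' v' where y: "y = (w', v')" by (cases y)
    have w': "length w' = m" "length v' = m" "(False, False) \<notin> set w'" "(False, False) \<notin> set v'" "compatible w' v'"
      using that by (auto simp: y compatible_pairs_def)
    have "{x \<in> ?S. \<phi> x = y} = {w. length w = n \<and> nonblank w = w'} \<times> {v. length v = n \<and> nonblank v = v'}"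
      (is "?L = ?R")
    proof (intro equalityI subsetI)
      fix x assume "x \<in> ?R"
      moreover from this have "compatible (fst x) (snd x)"
        using w'(5) compatible_nonblank[of "fst x" "snd x"] by (auto simp: mem_Times_iff)
      ultimately show "x \<in> ?L" by (auto simp: \<phi>_def y)
    qed (auto simp: \<phi>_def y)
    moreover have "sum ?h ?R = (\<Sum>x\<in>?R. fact (n - m))"
      using w'(1) by (intro sum.cong) auto
    ultimately show ?thesis
      using w' by (simp add: card_cartesian_product card_words_filter power2_eq_square)
  qed
  have "sum ?h ?S = (\<Sum>y\<in>(\<Union>m\<le>n. compatible_pairs m). sum ?h {x \<in> ?S. \<phi> x = y})"
    by (rule sum.group[symmetric, OF finS _ sub]) (simp add: finite_compatible_pairs)
  also have "\<dots> = (\<Sum>m\<le>n. \<Sum>y\<in>compatible_pairs m. sum ?h {x \<in> ?S. \<phi> x = y})"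
    by (intro sum.UNION_disjoint) (auto simp: finite_compatible_pairs, auto simp: compatible_pairs_def)
  also have "\<dots> = (\<Sum>m\<le>n. \<Sum>y\<in>compatible_pairs m. (n choose m)\<^sup>2 * fact (n - m))"
    by (intro sum.cong refl fib)
  also have "\<dots> = (\<Sum>m\<le>n. (n choose m)\<^sup>2 * fact (n - m) * card (compatible_pairs m))"
    by (simp add: mult.commute)
  finally show ?thesis .
qed

text \<open>
  Without common letters the two projections of a word are powers of single letters. Two words over
  \<open>a\<close> and \<open>b\<close> are then compatible when they contain each letter equally often, as for two shuffles
  of the same two blocks.
\<close>
definition shuffle_pairs :: "nat \<Rightarrow> ((bool \<times> bool) list \<times> (bool \<times> bool) list) set" where
  "shuffle_pairs s = {(w, v) \<in> compatible_pairs s. (True, True) \<notin> set w \<and> (True, True) \<notin> set v}"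

lemma no_common_letter:
  assumes "(False, False) \<notin> set w" "(True, True) \<notin> set w"
  shows "filter snd w = filter (\<lambda>x. x \<noteq> (True, False)) w"
    and "filter snd w = replicate (length w - length (filter fst w)) (False, True)"
    and "filter fst w = replicate (length (filter fst w)) (True, False)"
    and "length (filter fst w) + length (filter snd w) = length w"
proof -
  have "filter snd w = filter (\<lambda>x. x \<noteq> (True, False)) w \<and>
    filter snd w = replicate (length w - length (filter fst w)) (False, True) \<and>
    filter fst w = replicate (length (filter fst w)) (True, False) \<and>
    length (filter fst w) + length (filter snd w) = length w"
    using assms
  proof (induction w)
    case (Cons x w)
    have "length (filter fst w) \<le> length w" by simp
    with Cons show ?case by (cases x rule: prod.exhaust) (auto simp: Suc_diff_le)
  qed simp
  then show "filter snd w = filter (\<lambda>x. x \<noteq> (True, False)) w"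
    and "filter snd w = replicate (length w - length (filter fst w)) (False, True)"
    and "filter fst w = replicate (length (filter fst w)) (True, False)"
    and "length (filter fst w) + length (filter snd w) = length w" by blast+
qed

text \<open>
  A pair with \<open>b\<close> letters of the second kind consists of two arbitrary choices of \<open>b\<close> among \<open>s\<close>
  places, and \<open>\<Sum>b\<le>s. (s choose b)\<^sup>2 = (2 * s choose s)\<close>.
\<close>
lemma card_shuffle_pairs: "card (shuffle_pairs s) = (2 * s) choose s"
proof -
  define W where "W = (\<lambda>b. {w. length w = s \<and> filter (\<lambda>x. x \<noteq> (True, False)) w = replicate b (False, True)})"
  have W: "finite (W b)" "card (W b) = s choose b" for b
    unfolding W_def by (rule card_words_filter(1)) (subst card_words_filter(2), auto)
  have Wset: "(False, False) \<notin> set w \<and> (True, True) \<notin> set w" if "w \<in> W b" for w b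
  proof -
    have "set (filter (\<lambda>x. x \<noteq> (True, False)) w) \<subseteq> {(False, True)}" using that by (auto simp: W_def)
    then show ?thesis by auto
  qed
  have "shuffle_pairs s = (\<Union>b\<le>s. W b \<times> W b)"
  proof (intro equalityI subsetI)
    fix x assume "x \<in> shuffle_pairs s"
    then obtain w v where x: "x = (w, v)" "length w = s" "length v = s" "compatible w v"
       "(False, False) \<notin> set w" "(True, True) \<notin> set w" "(False, False) \<notin> set v" "(True, True) \<notin> set v"
      by (auto simp: shuffle_pairs_def compatible_pairs_def)
    define b where "b = length w - length (filter fst w)"
    have "w \<in> W b"
      using no_common_letter(1,2)[OF x(5,6)] x(2) by (simp add: W_def b_def)
    moreover have "v \<in> W b"
      using no_common_letter(1,2)[OF x(7,8)] x(2,3,4) by (simp add: W_def b_def compatible_def)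
    moreover have "b \<le> s" by (simp add: b_def x)
    ultimately show "x \<in> (\<Union>b\<le>s. W b \<times> W b)" using x by auto
  next
    fix x assume "x \<in> (\<Union>b\<le>s. W b \<times> W b)"
    then obtain b w v where x: "x = (w, v)" "w \<in> W b" "v \<in> W b" by auto
    have len: "length w = s" "length v = s" using x by (auto simp: W_def)
    have eq: "filter snd w = filter snd v"
      using x Wset[OF x(2)] Wset[OF x(3)] no_common_letter(1)[of w] no_common_letter(1)[of v]
      by (simp add: W_def)
    then have "length (filter fst w) = length (filter fst v)"
      using len Wset[OF x(2)] Wset[OF x(3)] no_common_letter(4)[of w] no_common_letter(4)[of v] by simp
    then have "filter fst w = filter fst v"
      using Wset[OF x(2)] Wset[OF x(3)] no_common_letter(3)[of w] no_common_letter(3)[of v] by simp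
    then show "x \<in> shuffle_pairs s"
      using eq len x Wset[OF x(2)] Wset[OF x(3)] by (simp add: shuffle_pairs_def compatible_pairs_def compatible_def)
  qed
  also have "card \<dots> = (\<Sum>b\<le>s. card (W b \<times> W b))"
    by (intro card_UN_disjoint) (auto simp: W, auto simp: W_def replicate_eq_replicate)
  also have "\<dots> = (\<Sum>b\<le>s. (s choose b)\<^sup>2)"
    by (simp add: card_cartesian_product W power2_eq_square)
  also have "\<dots> = (2 * s) choose s" by (rule choose_square_sum)
  finally show ?thesis .
qed

lemma append_Cons_first_eq:
  assumes "x \<notin> set xs" "x \<notin> set xs'" "xs @ x # ys = xs' @ x # ys'"
  shows "xs = xs' \<and> ys = ys'"
  using assms
proof (induction xs arbitrary: xs')
  case Nil
  then show ?case by (cases xs') auto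
next
  case (Cons a xs)
  then show ?case by (cases xs') auto
qed

text \<open>
  The letter \<open>(True, True)\<close> survives in both projections, so its first occurrence cuts each of the
  four projected words at matching places.
\<close>
lemma compatible_split:
  assumes "(True, True) \<notin> set w0" "(True, True) \<notin> set v0"
  shows "compatible (w0 @ (True, True) # w1) (v0 @ (True, True) # v1) \<longleftrightarrow> compatible w0 v0 \<and> compatible w1 v1"
proof
  assume "compatible (w0 @ (True, True) # w1) (v0 @ (True, True) # v1)"
  then have "filter fst w0 @ (True, True) # filter fst w1 = filter fst v0 @ (True, True) # filter fst v1"
    "filter snd w0 @ (True, True) # filter snd w1 = filter snd v0 @ (True, True) # filter snd v1"
    by (simp_all add: compatible_def)
  moreover have "(True, True) \<notin> set (filter fst w0)" "(True, True) \<notin> set (filter fst v0)"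
     "(True, True) \<notin> set (filter snd w0)" "(True, True) \<notin> set (filter snd v0)" using assms by auto
  ultimately show "compatible w0 v0 \<and> compatible w1 v1"
    unfolding compatible_def by (metis append_Cons_first_eq)
qed (simp add: compatible_def)

lemma compatible_common_letter:
  assumes "compatible w v"
  shows "(True, True) \<in> set w \<longleftrightarrow> (True, True) \<in> set v"
proof -
  have "set (filter fst w) = set (filter fst v)"
    using assms by (simp add: compatible_def)
  then show ?thesis by (auto simp: set_eq_iff)
qed

text \<open>
  Cut both words at their first common letter. The parts in front of it form a pair without common
  letters, of some length \<open>s\<close> that is the same for both words because it is the sum of the lengths of
  the projections; the parts behind it form an arbitrary compatible pair. The first summand belongs
  to the words in which no common letter occurs.
\<close>
lemma compatible_pairs_renewal:
  "card (compatible_pairs m) =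
    ((2 * m) choose m) + (\<Sum>s<m. ((2 * s) choose s) * card (compatible_pairs (m - 1 - s)))"
proof -
  \<comment> \<open>\<open>J\<close> glues the parts in front of and behind the first common letter together again.\<close>
  define J where "J = (\<lambda>((w0, v0), (w1, v1)). (w0 @ (True, True) # w1 :: (bool \<times> bool) list, v0 @ (True, True) # v1 :: (bool \<times> bool) list))"
  define X where "X = (\<lambda>s. shuffle_pairs s \<times> compatible_pairs (m - 1 - s))"
  have finS: "finite (shuffle_pairs s)" for s
    by (rule finite_subset[OF _ finite_compatible_pairs[of s]]) (auto simp: shuffle_pairs_def)
  have finX: "finite (X s)" for s
    unfolding X_def by (intro finite_cartesian_product finS finite_compatible_pairs)
  have injJ: "inj_on J (\<Union>s. X s)"
  proof (rule inj_onI)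
    fix x y assume xy: "x \<in> (\<Union>s. X s)" "y \<in> (\<Union>s. X s)" "J x = J y"
    obtain w0 v0 w1 v1 where x: "x = ((w0, v0), (w1, v1))" by (cases x) auto
    obtain w0' v0' w1' v1' where y: "y = ((w0', v0'), (w1', v1'))" by (cases y) auto
    have "(True, True) \<notin> set w0" "(True, True) \<notin> set v0" "(True, True) \<notin> set w0'" "(True, True) \<notin> set v0'"
      using xy(1,2) by (auto simp: x y X_def shuffle_pairs_def)
    moreover have "w0 @ (True, True) # w1 = w0' @ (True, True) # w1'" "v0 @ (True, True) # v1 = v0' @ (True, True) # v1'"
      using xy(3) by (simp_all add: x y J_def)
    ultimately have "w0 = w0' \<and> w1 = w1'" "v0 = v0' \<and> v1 = v1'"
      using append_Cons_first_eq[of "(True, True)" w0 w0' w1 w1'] append_Cons_first_eq[of "(True, True)" v0 v0' v1 v1']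
      by simp_all
    then show "x = y" by (simp add: x y)
  qed
  have split: "compatible_pairs m = shuffle_pairs m \<union> J ` (\<Union>s<m. X s)"
  proof (intro equalityI subsetI)
    fix x assume "x \<in> compatible_pairs m"
    then obtain w v where x: "x = (w, v)" "length w = m" "length v = m" "compatible w v"
       "(False, False) \<notin> set w" "(False, False) \<notin> set v"
      by (auto simp: compatible_pairs_def)
    show "x \<in> shuffle_pairs m \<union> J ` (\<Union>s<m. X s)"
    proof (cases "(True, True) \<in> set w")
      case False
      then show ?thesis using x compatible_common_letter[OF x(4)]
        by (auto simp: shuffle_pairs_def compatible_pairs_def)
    next
      case True
      then obtain w0 w1 where w: "w = w0 @ (True, True) # w1" "(True, True) \<notin> set w0"
        using split_list_first by metis
      from True have "(True, True) \<in> set v" using compatible_common_letter[OF x(4)] by simp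
      then obtain v0 v1 where v: "v = v0 @ (True, True) # v1" "(True, True) \<notin> set v0"
        using split_list_first by metis
      have c: "compatible w0 v0" "compatible w1 v1"
        using compatible_split[OF w(2) v(2), of w1 v1] x(4) by (auto simp: w v)
      have ff: "(False, False) \<notin> set w0" "(False, False) \<notin> set v0" "(False, False) \<notin> set w1" "(False, False) \<notin> set v1"
        using x(5,6) by (auto simp: w v)
      have len: "length w0 = length v0"
        using no_common_letter(4)[OF ff(1) w(2)] no_common_letter(4)[OF ff(2) v(2)] c(1)
        by (simp add: compatible_def)
      have "((w0, v0), (w1, v1)) \<in> X (length w0)"
        using c ff len w v x by (auto simp: X_def shuffle_pairs_def compatible_pairs_def)
      moreover have "length w0 < m" using x(2) w by simp
      moreover have "x = J ((w0, v0), (w1, v1))" by (simp add: J_def x w v)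
      ultimately show ?thesis by blast
    qed
  next
    fix x assume "x \<in> shuffle_pairs m \<union> J ` (\<Union>s<m. X s)"
    then show "x \<in> compatible_pairs m"
    proof
      assume "x \<in> J ` (\<Union>s<m. X s)"
      then obtain s w0 v0 w1 v1 where x: "s < m" "((w0, v0), (w1, v1)) \<in> X s" "x = J ((w0, v0), (w1, v1))"
        by auto
      then show ?thesis
        using compatible_split[of w0 v0 w1 v1]
        by (auto simp: X_def J_def shuffle_pairs_def compatible_pairs_def)
    qed (auto simp: shuffle_pairs_def)
  qed
  have disj: "shuffle_pairs m \<inter> J ` (\<Union>s<m. X s) = {}"
    by (auto simp: shuffle_pairs_def J_def)
  have "card (compatible_pairs m) = card (shuffle_pairs m) + card (J ` (\<Union>s<m. X s))"
    unfolding split using disj finS finX by (intro card_Un_disjoint) auto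
  also have "card (J ` (\<Union>s<m. X s)) = card (\<Union>s<m. X s)"
    by (intro card_image inj_on_subset[OF injJ]) auto
  also have "\<dots> = (\<Sum>s<m. card (X s))"
    using finX by (intro card_UN_disjoint) (auto, auto simp: X_def shuffle_pairs_def compatible_pairs_def)
  also have "\<dots> = (\<Sum>s<m. ((2 * s) choose s) * card (compatible_pairs (m - 1 - s)))"
    by (simp add: X_def card_cartesian_product card_shuffle_pairs)
  finally show ?thesis by (simp add: card_shuffle_pairs)
qed

section \<open>Moments of the number of increasing sets\<close>

lemma bij_betw_label_word:
  "bij_betw (\<lambda>(A, B). label_word n A B) (Pow {1..n} \<times> Pow {1..n}) {w. length w = n}"
proof -
  define D where "D = (\<lambda>w :: (bool \<times> bool) list. ({i \<in> {1..n}. fst (w ! (i - 1))}, {i \<in> {1..n}. snd (w ! (i - 1))}))"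
  show ?thesis
  proof (rule bij_betw_byWitness[where f' = D])
    have nth: "label_word n A B ! (i - 1) = (i \<in> A, i \<in> B)" if "i \<in> {1..n}" for A B i
      using that by (cases i) (auto simp: label_word_def simp del: upt_Suc)
    show "\<forall>x\<in>Pow {1..n} \<times> Pow {1..n}. D ((\<lambda>(A, B). label_word n A B) x) = x"
    proof
      fix x assume x: "x \<in> Pow {1..n} \<times> Pow {1..n}"
      obtain A B where AB: "x = (A, B)" "A \<in> Pow {1..n}" "B \<in> Pow {1..n}" using x by auto
      have "{i \<in> {1..n}. fst (label_word n A B ! (i - 1))} = {i \<in> {1..n}. i \<in> A}"
        "{i \<in> {1..n}. snd (label_word n A B ! (i - 1))} = {i \<in> {1..n}. i \<in> B}"
        using nth by (auto simp del: atLeastAtMost_iff)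
      then show "D ((\<lambda>(A, B). label_word n A B) x) = x"
        using AB unfolding D_def by auto
    qed
    show "\<forall>w\<in>{w. length w = n}. (\<lambda>(A, B). label_word n A B) (D w) = w"
    proof
      fix w :: "(bool \<times> bool) list" assume w: "w \<in> {w. length w = n}"
      show "(\<lambda>(A, B). label_word n A B) (D w) = w"
        by (rule nth_equalityI) (use w in \<open>auto simp: label_word_def D_def simp del: upt_Suc\<close>)
    qed
    show "(\<lambda>(A, B). label_word n A B) ` (Pow {1..n} \<times> Pow {1..n}) \<subseteq> {w. length w = n}"
      by (auto simp: label_word_def)
    show "D ` {w. length w = n} \<subseteq> Pow {1..n} \<times> Pow {1..n}"
      by (auto simp: D_def)
  qed
qed

lemma length_nonblank_label_word:
  assumes "A \<subseteq> {1..n}" "B \<subseteq> {1..n}"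
  shows "length (nonblank (label_word n A B)) = card (A \<union> B)"
proof -
  have "length (nonblank (label_word n A B)) = length (filter (\<lambda>i. i \<in> A \<union> B) [1..<Suc n])"
    by (simp add: label_word_def filter_map comp_def del: upt_Suc)
  also have "\<dots> = length (sorted_list_of_set (A \<union> B))"
    by (subst filter_mem_upt) (use assms in auto)
  finally show ?thesis by simp
qed

text \<open>
  Expand the square into a sum over pairs \<open>(A, B)\<close>, sort the permutations by the images
  \<open>(\<sigma> ` A, \<sigma> ` B)\<close>, and pass to label words.
\<close>
lemma second_moment_increasing_sets:
  "(\<Sum>\<sigma> | \<sigma> permutes {1..n}. (card (increasing_sets n \<sigma>))\<^sup>2) =
   (\<Sum>m\<le>n. (n choose m)\<^sup>2 * fact (n - m) * card (compatible_pairs m))"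
proof -
  define I where "I = Pow {1..n} \<times> Pow {1..n}"
  define lw where "lw = (\<lambda>(A, B). label_word n A B)"
  define F where "F = (\<lambda>x y. order_fibre n (fst x) (snd x) (fst y) (snd y))"
  have finI: "finite I" by (simp add: I_def)
  have finP: "finite {\<sigma>. \<sigma> permutes {1..n}}" by (simp add: finite_permutations)
  have one: "(card (increasing_sets n \<sigma>))\<^sup>2 = (\<Sum>x\<in>I. \<Sum>y\<in>I. of_bool (\<sigma> \<in> F x y))" if "\<sigma> permutes {1..n}" for \<sigma>
  proof -
    have "(\<Sum>y\<in>I. of_bool (\<sigma> \<in> F x y)) = (of_bool (x \<in> increasing_sets n \<sigma> \<times> increasing_sets n \<sigma>) :: nat)"
      if x: "x \<in> I" for x
    proof -
      obtain A B where AB: "x = (A, B)" "A \<subseteq> {1..n}" "B \<subseteq> {1..n}" using x by (auto simp: I_def)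
      have im: "(\<sigma> ` A, \<sigma> ` B) \<in> I"
        using AB permutes_image[OF \<open>\<sigma> permutes {1..n}\<close>] by (auto simp: I_def)
      have "(\<Sum>y\<in>I. of_bool (\<sigma> \<in> F x y)) =
         (\<Sum>y\<in>I. if y = (\<sigma> ` A, \<sigma> ` B) then (of_bool (x \<in> increasing_sets n \<sigma> \<times> increasing_sets n \<sigma>) :: nat) else 0)"
        using AB \<open>\<sigma> permutes {1..n}\<close>
        by (intro sum.cong) (auto simp: F_def order_fibre_def increasing_sets_def)
      also have "\<dots> = of_bool (x \<in> increasing_sets n \<sigma> \<times> increasing_sets n \<sigma>)"
        using im finI by simp
      finally show ?thesis .
    qed
    then have "(\<Sum>x\<in>I. \<Sum>y\<in>I. of_bool (\<sigma> \<in> F x y)) =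
        (\<Sum>x\<in>I. of_bool (x \<in> increasing_sets n \<sigma> \<times> increasing_sets n \<sigma>) :: nat)"
      by (intro sum.cong refl)
    also have "\<dots> = card (I \<inter> (increasing_sets n \<sigma> \<times> increasing_sets n \<sigma>))"
      using finI by (simp add: of_bool_def sum.If_cases Collect_mem_eq)
    also have "I \<inter> (increasing_sets n \<sigma> \<times> increasing_sets n \<sigma>) = increasing_sets n \<sigma> \<times> increasing_sets n \<sigma>"
      by (auto simp: I_def increasing_sets_def)
    finally show ?thesis by (simp add: card_cartesian_product power2_eq_square)
  qed
  have "(\<Sum>\<sigma> | \<sigma> permutes {1..n}. (card (increasing_sets n \<sigma>))\<^sup>2) =
      (\<Sum>\<sigma> | \<sigma> permutes {1..n}. \<Sum>x\<in>I. \<Sum>y\<in>I. of_bool (\<sigma> \<in> F x y))"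
    using one by (intro sum.cong) auto
  also have "\<dots> = (\<Sum>x\<in>I. \<Sum>\<sigma> | \<sigma> permutes {1..n}. \<Sum>y\<in>I. of_bool (\<sigma> \<in> F x y))"
    by (rule sum.swap)
  also have "\<dots> = (\<Sum>x\<in>I. \<Sum>y\<in>I. \<Sum>\<sigma> | \<sigma> permutes {1..n}. of_bool (\<sigma> \<in> F x y))"
    by (intro sum.cong refl sum.swap)
  also have "\<dots> = (\<Sum>x\<in>I. \<Sum>y\<in>I. if compatible (lw x) (lw y) then fact (n - length (nonblank (lw x))) else 0)"
  proof (intro sum.cong refl)
    fix x y assume "x \<in> I" "y \<in> I"
    then obtain A B A' B' where xy: "x = (A, B)" "y = (A', B')" "A \<subseteq> {1..n}" "B \<subseteq> {1..n}" "A' \<subseteq> {1..n}" "B' \<subseteq> {1..n}"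
      by (auto simp: I_def)
    have "(\<Sum>\<sigma> | \<sigma> permutes {1..n}. of_bool (\<sigma> \<in> F x y)) = card ({\<sigma>. \<sigma> permutes {1..n}} \<inter> F x y)"
      using finP by (simp add: of_bool_def sum.If_cases Collect_mem_eq)
    also have "{\<sigma>. \<sigma> permutes {1..n}} \<inter> F x y = F x y" by (auto simp: F_def order_fibre_def)
    also have "card (F x y) = (if compatible (lw x) (lw y) then fact (n - length (nonblank (lw x))) else 0)"
      using order_fibre_nonempty_iff[OF xy(3-6)] card_order_fibre[OF xy(3,4), of A' B']
        length_nonblank_label_word[OF xy(3,4)]
      by (auto simp: F_def lw_def xy(1,2))
    finally show "(\<Sum>\<sigma> | \<sigma> permutes {1..n}. of_bool (\<sigma> \<in> F x y)) =
       (if compatible (lw x) (lw y) then fact (n - length (nonblank (lw x))) else (0 :: nat))" .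
  qed
  also have "\<dots> = (\<Sum>w | length w = n. \<Sum>v | length v = n. if compatible w v then fact (n - length (nonblank w)) else 0)"
  proof -
    have bij: "bij_betw lw I {w. length w = n}" unfolding lw_def I_def by (rule bij_betw_label_word)
    have "(\<Sum>x\<in>I. \<Sum>y\<in>I. if compatible (lw x) (lw y) then fact (n - length (nonblank (lw x))) else 0) =
       (\<Sum>x\<in>I. \<Sum>v | length v = n. if compatible (lw x) v then fact (n - length (nonblank (lw x))) else (0 :: nat))"
      by (intro sum.cong refl sum.reindex_bij_betw[OF bij])
    also have "\<dots> = (\<Sum>w | length w = n. \<Sum>v | length v = n. if compatible w v then fact (n - length (nonblank w)) else 0)"
      by (rule sum.reindex_bij_betw[OF bij])
    finally show ?thesis .
  qed
  also have "\<dots> = (\<Sum>(w, v)\<in>{w. length w = n} \<times> {v. length v = n}. if compatible w v then fact (n - length (nonblank w)) else 0)"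
    by (simp add: sum.cartesian_product)
  also have "\<dots> = (\<Sum>(w, v)\<in>{(w, v). length w = n \<and> length v = n \<and> compatible w v}. fact (n - length (nonblank w)))"
    by (rule sum.mono_neutral_cong_right) (auto simp: finite_words split: if_splits)
  also have "\<dots> = (\<Sum>m\<le>n. (n choose m)\<^sup>2 * fact (n - m) * card (compatible_pairs m))"
    by (rule sum_compatible_words)
  finally show ?thesis .
qed

text \<open>
  The case \<open>A = B\<close> of the same count: a fibre over \<open>(A, A')\<close> is nonempty as soon as the
  cardinalities agree.
\<close>
lemma first_moment_increasing_sets:
  "(\<Sum>\<sigma> | \<sigma> permutes {1..n}. card (increasing_sets n \<sigma>)) = (\<Sum>k\<le>n. (n choose k)\<^sup>2 * fact (n - k))"
proof -
  define I where "I = Pow {1..n}"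
  have finI: "finite I" by (simp add: I_def)
  have finP: "finite {\<sigma>. \<sigma> permutes {1..n}}" by (simp add: finite_permutations)
  have cardF: "card (order_fibre n A A A' A') = (if card A' = card A then fact (n - card A) else 0)"
    if "A \<in> I" "A' \<in> I" for A A'
  proof (cases "card A' = card A")
    case True
    have sub: "A \<subseteq> {1..n}" "A' \<subseteq> {1..n}" using that by (auto simp: I_def)
    have fin: "finite A" "finite A'" using finite_subset[OF sub(1)] finite_subset[OF sub(2)] by simp_all
    obtain f where f: "strict_mono_on A f" "f ` A = A'"
      using ex_strict_mono_on_image[OF fin] True by auto
    obtain \<tau> where \<tau>: "\<tau> permutes {1..n}" "\<forall>x\<in>A. \<tau> x = f x"
      using ex_permutation_extending[of "{1..n}" A f] f sub strict_mono_on_imp_inj_on[OF f(1)] by auto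
    have "\<tau> ` A = A'" using f(2) \<tau>(2) by (metis image_cong)
    moreover have "strict_mono_on A \<tau>" using f(1) \<tau>(2) by (simp add: strict_mono_on_def)
    ultimately have "\<tau> \<in> order_fibre n A A A' A'" using \<tau>(1) by (simp add: order_fibre_def)
    then show ?thesis using card_order_fibre[OF sub(1) sub(1), of A' A'] True by auto
  next
    case False
    have "order_fibre n A A A' A' = {}"
      using False by (auto simp: order_fibre_def card_image strict_mono_on_imp_inj_on)
    then show ?thesis using False by simp
  qed
  have one: "card (increasing_sets n \<sigma>) = (\<Sum>A\<in>I. \<Sum>A'\<in>I. of_bool (\<sigma> \<in> order_fibre n A A A' A'))"
    if \<sigma>: "\<sigma> permutes {1..n}" for \<sigma>
  proof -
    have "(\<Sum>A'\<in>I. of_bool (\<sigma> \<in> order_fibre n A A A' A')) = (of_bool (A \<in> increasing_sets n \<sigma>) :: nat)"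
      if A: "A \<in> I" for A
    proof -
      have im: "\<sigma> ` A \<in> I" using A permutes_image[OF \<sigma>] by (auto simp: I_def)
      have "(\<Sum>A'\<in>I. of_bool (\<sigma> \<in> order_fibre n A A A' A')) =
          (\<Sum>A'\<in>I. if A' = \<sigma> ` A then (of_bool (A \<in> increasing_sets n \<sigma>) :: nat) else 0)"
        using A \<sigma> by (intro sum.cong) (auto simp: I_def order_fibre_def increasing_sets_def)
      also have "\<dots> = of_bool (A \<in> increasing_sets n \<sigma>)" using im finI by simp
      finally show ?thesis .
    qed
    then have "(\<Sum>A\<in>I. \<Sum>A'\<in>I. of_bool (\<sigma> \<in> order_fibre n A A A' A')) =
        (\<Sum>A\<in>I. of_bool (A \<in> increasing_sets n \<sigma>) :: nat)"
      by (intro sum.cong refl)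
    also have "\<dots> = card (I \<inter> increasing_sets n \<sigma>)"
      using finI by (simp add: of_bool_def sum.If_cases Collect_mem_eq)
    also have "I \<inter> increasing_sets n \<sigma> = increasing_sets n \<sigma>" by (auto simp: I_def increasing_sets_def)
    finally show ?thesis by simp
  qed
  have cardI: "card {A \<in> I. card A = k} = n choose k" for k
    using n_subsets[of "{1..n}" k] by (simp add: I_def)
  have "(\<Sum>\<sigma> | \<sigma> permutes {1..n}. card (increasing_sets n \<sigma>)) =
      (\<Sum>\<sigma> | \<sigma> permutes {1..n}. \<Sum>A\<in>I. \<Sum>A'\<in>I. of_bool (\<sigma> \<in> order_fibre n A A A' A'))"
    using one by (intro sum.cong) auto
  also have "\<dots> = (\<Sum>A\<in>I. \<Sum>\<sigma> | \<sigma> permutes {1..n}. \<Sum>A'\<in>I. of_bool (\<sigma> \<in> order_fibre n A A A' A'))"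
    by (rule sum.swap)
  also have "\<dots> = (\<Sum>A\<in>I. \<Sum>A'\<in>I. \<Sum>\<sigma> | \<sigma> permutes {1..n}. of_bool (\<sigma> \<in> order_fibre n A A A' A'))"
    by (intro sum.cong refl sum.swap)
  also have "\<dots> = (\<Sum>A\<in>I. \<Sum>A'\<in>I. if card A' = card A then fact (n - card A) else 0)"
  proof (intro sum.cong refl)
    fix A A' assume "A \<in> I" "A' \<in> I"
    have "(\<Sum>\<sigma> | \<sigma> permutes {1..n}. of_bool (\<sigma> \<in> order_fibre n A A A' A')) =
        card ({\<sigma>. \<sigma> permutes {1..n}} \<inter> order_fibre n A A A' A')"
      using finP by (simp add: of_bool_def sum.If_cases Collect_mem_eq)
    also have "{\<sigma>. \<sigma> permutes {1..n}} \<inter> order_fibre n A A A' A' = order_fibre n A A A' A'"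
      by (auto simp: order_fibre_def)
    finally show "(\<Sum>\<sigma> | \<sigma> permutes {1..n}. of_bool (\<sigma> \<in> order_fibre n A A A' A')) =
        (if card A' = card A then fact (n - card A) else (0 :: nat))"
      using cardF[OF \<open>A \<in> I\<close> \<open>A' \<in> I\<close>] by simp
  qed
  also have "\<dots> = (\<Sum>A\<in>I. (n choose card A) * fact (n - card A))"
  proof (intro sum.cong refl)
    fix A
    have "I \<inter> {A'. card A' = card A} = {A' \<in> I. card A' = card A}" by auto
    then show "(\<Sum>A'\<in>I. if card A' = card A then fact (n - card A) else 0) = (n choose card A) * fact (n - card A)"
      using finI cardI by (simp add: sum.If_cases)
  qed
  also have "\<dots> = (\<Sum>k\<le>n. \<Sum>A | A \<in> I \<and> card A = k. (n choose card A) * fact (n - card A))"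
  proof (rule sum.group[symmetric, OF finI])
    show "card ` I \<subseteq> {..n}" using card_mono[of "{1..n}"] by (fastforce simp: I_def)
  qed simp
  also have "\<dots> = (\<Sum>k\<le>n. (n choose k)\<^sup>2 * fact (n - k))"
    by (intro sum.cong refl) (simp add: cardI power2_eq_square)
  finally show ?thesis .
qed

section \<open>The renewal equation\<close>

lemma gbinomial_minus_half:
  "(-4) ^ s * ((- 1 / 2 :: real) gchoose s) = real ((2 * s) choose s)"
proof (induction s)
  case (Suc s)
  have "real (Suc s) * ((- 1 / 2 :: real) gchoose Suc s) = (- 1 / 2 - real s) * ((-1/2) gchoose s)"
    by (metis gbinomial_absorption' gbinomial_mult_1' gbinomial_absorb_comp Suc_eq_plus1 gbinomial_mult_1 add_diff_cancel_left' left_diff_distrib mult.commute)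
  then have a: "((- 1 / 2 :: real) gchoose Suc s) = - (2 * real s + 1) / (2 * real (Suc s)) * ((-1/2) gchoose s)"
    by (simp add: field_simps)
  have b: "real ((2 * Suc s) choose Suc s) = 2 * (2 * real s + 1) / real (Suc s) * real ((2 * s) choose s)"
  proof -
    have "2 * Suc s = Suc (Suc (2 * s))" by simp
    then have "(fact (2 * Suc s) :: real) = (2 * real s + 2) * (2 * real s + 1) * fact (2 * s)"
      by (simp only: fact_Suc) (simp add: algebra_simps)
    moreover have "(2 * real s + 2) * (2 * real s + 1) * f / (((real s + 1) * g) * ((real s + 1) * g)) =
        2 * (2 * real s + 1) / (real s + 1) * (f / (g * g))" if "g > 0" for f g :: real
    proof -
      have "(2 * real s + 2) * (2 * real s + 1) * f / (((real s + 1) * g) * ((real s + 1) * g)) =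
        (real s + 1) * (2 * (2 * real s + 1) * f) / ((real s + 1) * ((real s + 1) * (g * g)))"
        by (simp add: algebra_simps)
      also have "\<dots> = 2 * (2 * real s + 1) * f / ((real s + 1) * (g * g))"
        by (subst mult_divide_mult_cancel_left) auto
      finally show ?thesis by simp
    qed
    from this[of "fact s" "fact (2 * s)"] have "(2 * real s + 2) * (2 * real s + 1) * fact (2 * s) / (fact (Suc s) * fact (Suc s)) =
        2 * (2 * real s + 1) / (real s + 1) * (fact (2 * s) / (fact s * fact s))"
      by (simp add: fact_Suc add.commute)
    moreover have "real ((2 * Suc s) choose Suc s) = fact (2 * Suc s) / (fact (Suc s) * fact (Suc s))"
      by (subst binomial_fact) (simp_all del: fact_Suc)
    moreover have "real ((2 * s) choose s) = fact (2 * s) / (fact s * fact s)"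
      by (subst binomial_fact) (simp_all del: fact_Suc)
    ultimately show ?thesis by (simp only: of_nat_Suc add.commute)
  qed
  show ?case unfolding a b Suc.IH[symmetric] by (simp add: field_simps)
qed simp

text \<open>
  The distance to the fixed point \<open>L / (1 + q)\<close> satisfies \<open>e (Suc m) \<le> q * e m + o(1)\<close>, so it
  contracts to \<open>0\<close>.
\<close>
lemma tendsto_of_affine_recurrence:
  fixes a b :: "nat \<Rightarrow> real"
  assumes rec: "\<And>m. a (Suc m) = b m - q * a m" and q: "0 \<le> q" "q < 1" and b: "b \<longlonglongrightarrow> L"
  shows "a \<longlonglongrightarrow> L / (1 + q)"
proof -
  define e where "e = (\<lambda>m. \<bar>a m - L / (1 + q)\<bar>)"
  have e: "e (Suc m) \<le> \<bar>b m - L\<bar> + q * e m" for m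
  proof -
    have "a (Suc m) - L / (1 + q) = (b m - L) - q * (a m - L / (1 + q))"
      using q by (simp add: rec field_simps)
    then show ?thesis unfolding e_def using q
      by (metis abs_mult abs_of_nonneg abs_triangle_ineq4)
  qed
  have "e \<longlonglongrightarrow> 0"
    unfolding tendsto_iff
  proof (intro allI impI)
    fix \<epsilon> :: real assume \<epsilon>: "\<epsilon> > 0"
    define \<eta> where "\<eta> = \<epsilon> / 2 * (1 - q)"
    have "\<eta> > 0" using \<epsilon> q by (simp add: \<eta>_def)
    with b obtain N where N: "\<And>m. m \<ge> N \<Longrightarrow> \<bar>b m - L\<bar> < \<eta>"
      by (auto simp: LIMSEQ_def dist_real_def)
    \<comment> \<open>The constant \<open>\<eta>\<close> is chosen so that \<open>\<epsilon> / 2\<close> is the fixed point of \<open>y \<mapsto> \<eta> + q * y\<close>.\<close>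
    have bound: "e (N + i) \<le> q ^ i * e N + \<epsilon> / 2" for i
    proof (induction i)
      case 0
      then show ?case using \<epsilon> by simp
    next
      case (Suc i)
      have "e (N + Suc i) \<le> \<eta> + q * (q ^ i * e N + \<epsilon> / 2)"
        using e[of "N + i"] N[of "N + i"] mult_left_mono[OF Suc.IH q(1)] by simp
      also have "\<dots> = q ^ Suc i * e N + \<epsilon> / 2"
        by (simp add: \<eta>_def field_simps)
      finally show ?case .
    qed
    have "(\<lambda>i. q ^ i * e N) \<longlonglongrightarrow> 0 * e N"
      using q by (intro tendsto_intros LIMSEQ_realpow_zero)
    then have "\<forall>\<^sub>F i in sequentially. q ^ i * e N < \<epsilon> / 2"
      using \<epsilon> by (intro order_tendstoD) auto
    then have "\<forall>\<^sub>F i in sequentially. dist (e (i + N)) 0 < \<epsilon>"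
    proof eventually_elim
      case (elim i)
      have "e (i + N) \<ge> 0" by (simp add: e_def)
      then show ?case using bound[of i] elim by (simp add: dist_real_def add.commute)
    qed
    then show "\<forall>\<^sub>F m in sequentially. dist (e m) 0 < \<epsilon>"
      by (rule eventually_sequentially_seg[THEN iffD1])
  qed
  then show ?thesis
    unfolding e_def by (simp add: tendsto_rabs_zero_iff LIM_zero_iff)
qed

text \<open>
  The binomial series of \<open>(1 - 4 X) powr a\<close>.
\<close>
definition fps_one_minus_4X_powr :: "real \<Rightarrow> real fps" where
  "fps_one_minus_4X_powr a = Abs_fps (\<lambda>l. (-4) ^ l * (a gchoose l))"

text \<open>
  Addition of exponents is Vandermonde's identity.
\<close>
lemma fps_one_minus_4X_powr_mult: "fps_one_minus_4X_powr a * fps_one_minus_4X_powr b = fps_one_minus_4X_powr (a + b)"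
proof (rule fps_ext)
  fix n
  have "fps_nth (fps_one_minus_4X_powr a * fps_one_minus_4X_powr b) n =
     (\<Sum>i=0..n. (-4) ^ i * (-4) ^ (n - i) * ((a gchoose i) * (b gchoose (n - i))))"
    by (simp add: fps_one_minus_4X_powr_def fps_mult_nth mult_ac)
  also have "\<dots> = (\<Sum>i=0..n. (-4) ^ n * ((a gchoose i) * (b gchoose (n - i))))"
    by (intro sum.cong refl) (simp flip: power_add)
  also have "\<dots> = (-4) ^ n * (a + b gchoose n)"
    by (simp add: sum_distrib_left[symmetric] gbinomial_Vandermonde)
  finally show "fps_nth (fps_one_minus_4X_powr a * fps_one_minus_4X_powr b) n = fps_nth (fps_one_minus_4X_powr (a + b)) n"
    by (simp add: fps_one_minus_4X_powr_def)
qed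

lemma fps_one_minus_4X_powr_0: "fps_one_minus_4X_powr 0 = 1"
  by (rule fps_ext) (auto simp: fps_one_minus_4X_powr_def gbinomial_0_left)

lemma fps_one_minus_4X_powr_1: "fps_one_minus_4X_powr 1 = 1 - 4 * fps_X"
proof (rule fps_ext)
  fix n
  show "fps_nth (fps_one_minus_4X_powr 1) n = fps_nth (1 - 4 * fps_X) n"
    using binomial_gbinomial[where 'a = real, of 1 n]
    by (cases "n \<ge> 2") (auto simp: fps_one_minus_4X_powr_def numeral_fps_const not_le less_2_cases_iff binomial_eq_0)
qed

lemma fps_one_minus_4X_powr_minus_half: "fps_one_minus_4X_powr (-1/2) = Abs_fps (\<lambda>s. real ((2 * s) choose s))"
  using gbinomial_minus_half by (simp add: fps_one_minus_4X_powr_def)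

lemma fps_one_minus_4X_powr_power: "fps_one_minus_4X_powr a ^ j = fps_one_minus_4X_powr (real j * a)"
  by (induction j) (auto simp: fps_one_minus_4X_powr_0 fps_one_minus_4X_powr_mult algebra_simps)

context
  fixes N :: "nat \<Rightarrow> real"
  assumes N: "\<And>m. N m = real ((2 * m) choose m) + (\<Sum>s<m. real ((2 * s) choose s) * N (m - 1 - s))"
begin

lemma renewal_fps:
  "Abs_fps N = fps_one_minus_4X_powr (-1/2) + fps_X * fps_one_minus_4X_powr (-1/2) * Abs_fps N"
proof (rule fps_ext)
  fix m
  show "fps_nth (Abs_fps N) m = fps_nth (fps_one_minus_4X_powr (-1/2) + fps_X * fps_one_minus_4X_powr (-1/2) * Abs_fps N) m"
  proof (cases m)
    case 0
    have "N 0 = 1" by (subst N) (simp only: lessThan_0 sum.empty, simp)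
    with 0 show ?thesis by (simp add: fps_one_minus_4X_powr_def)
  next
    case (Suc m')
    have "fps_nth (fps_X * fps_one_minus_4X_powr (-1/2) * Abs_fps N) m = (\<Sum>s<m. real ((2 * s) choose s) * N (m - 1 - s))"
      unfolding fps_one_minus_4X_powr_minus_half mult.assoc Suc
      by (simp only: fps_X_mult_nth nat.simps if_False diff_Suc_1)
        (simp only: fps_mult_nth fps_nth_Abs_fps atLeast0AtMost lessThan_Suc_atMost)
    then show ?thesis
      by (simp only: fps_nth_Abs_fps fps_add_nth fps_one_minus_4X_powr_minus_half trans[OF N[of m]])
  qed
qed

text \<open>
  With \<open>D = 1 / sqrt (1 - 4 X)\<close> the equation \<open>G = D + X D G\<close> iterates to
  \<open>G = \<Sum>k. X ^ k * D ^ (k + 1)\<close>, and \<open>D ^ (k + 1)\<close> is the binomial series with exponent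
  \<open>- (k + 1) / 2\<close>. Finitely many iterations suffice for the coefficient of \<open>X ^ m\<close>.
\<close>
lemma renewal_explicit:
  "N m = (\<Sum>l\<le>m. 4 ^ l * (((real (m - l) + 1) / 2 + real l - 1) gchoose l))"
proof -
  define D where "D = fps_one_minus_4X_powr (-1/2)"
  define G where "G = Abs_fps N"
  have G: "G = D + fps_X * D * G" unfolding D_def G_def by (rule renewal_fps)
  have iter: "G = (\<Sum>k\<le>m. fps_X ^ k * D ^ Suc k) + fps_X ^ Suc m * (D ^ Suc m * G)" for m
  proof (induction m)
    case 0
    show ?case by (rule trans[OF G]) (simp add: mult.assoc)
  next
    case (Suc m)
    have "fps_X ^ Suc m * (D ^ Suc m * G) = fps_X ^ Suc m * (D ^ Suc m * (D + fps_X * D * G))"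
      by (rule arg_cong[OF G, of "\<lambda>H. fps_X ^ Suc m * (D ^ Suc m * H)"])
    also have "\<dots> = fps_X ^ Suc m * D ^ Suc (Suc m) + fps_X ^ Suc (Suc m) * (D ^ Suc (Suc m) * G)"
      by (simp add: algebra_simps)
    finally have step: "fps_X ^ Suc m * (D ^ Suc m * G) =
        fps_X ^ Suc m * D ^ Suc (Suc m) + fps_X ^ Suc (Suc m) * (D ^ Suc (Suc m) * G)" .
    show ?case
      by (rule trans[OF Suc.IH]) (simp only: step sum.atMost_Suc add.assoc)
  qed
  have "N m = fps_nth G m" by (simp add: G_def)
  also have "\<dots> = fps_nth (\<Sum>k\<le>m. fps_X ^ k * D ^ Suc k) m + fps_nth (fps_X ^ Suc m * (D ^ Suc m * G)) m"
    by (rule trans[OF arg_cong[OF iter[of m], of "\<lambda>H. fps_nth H m"] fps_add_nth])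
  also have "fps_nth (fps_X ^ Suc m * (D ^ Suc m * G)) m = 0"
    by (simp only: fps_X_power_mult_nth) simp
  also have "fps_nth (\<Sum>k\<le>m. fps_X ^ k * D ^ Suc k) m = (\<Sum>k\<le>m. fps_nth (D ^ Suc k) (m - k))"
    unfolding fps_sum_nth by (intro sum.cong refl) (simp add: fps_X_power_mult_nth del: power_Suc)
  also have "\<dots> = (\<Sum>l\<le>m. fps_nth (D ^ Suc (m - l)) (m - (m - l)))"
    by (rule sum.reindex_bij_witness[of _ "\<lambda>l. m - l" "\<lambda>k. m - k"]) auto
  also have "\<dots> = (\<Sum>l\<le>m. 4 ^ l * (((real (m - l) + 1) / 2 + real l - 1) gchoose l))"
  proof (intro sum.cong refl)
    fix l assume "l \<in> {..m}"
    then have "m - (m - l) = l" by simp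
    moreover have "fps_nth (D ^ Suc (m - l)) l = (-4) ^ l * ((- ((real (m - l) + 1) / 2)) gchoose l)"
      unfolding D_def fps_one_minus_4X_powr_power by (simp add: fps_one_minus_4X_powr_def add.commute)
    moreover have "\<dots> = 4 ^ l * (((real (m - l) + 1) / 2 + real l - 1) gchoose l)"
      unfolding gbinomial_minus mult.assoc[symmetric] power_mult_distrib[symmetric] by simp
    ultimately show "fps_nth (D ^ Suc (m - l)) (m - (m - l)) = 4 ^ l * (((real (m - l) + 1) / 2 + real l - 1) gchoose l)"
      by simp
  qed
  finally show ?thesis by (simp only: add_0_right)
qed

text \<open>
  Rationalising \<open>G = 1 / (sqrt (1 - 4 X) - X)\<close> gives \<open>(1 - 4 X - X\<^sup>2) G = sqrt (1 - 4 X) + X\<close>, where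
  \<open>1 - 4 X - X\<^sup>2 = (1 - X / r) (1 + r X)\<close> with \<open>r = sqrt 5 - 2 = 1 / (2 + sqrt 5)\<close>. The right-hand side
  converges at \<open>X = r\<close>, because \<open>r < 1/4\<close>, with value \<open>2 r > 0\<close>. Dividing by the factor
  \<open>1 - X / r\<close> means taking partial sums of this convergent series, and dividing by \<open>1 + r X\<close> is an
  affine recurrence with ratio \<open>- r\<^sup>2\<close>.
\<close>
lemma renewal_growth:
  "\<exists>c>0. (\<lambda>m. N m / (2 + sqrt 5) ^ m) \<longlonglongrightarrow> c"
proof -
  define r where "r = sqrt 5 - 2"
  have s5: "2 < sqrt (5::real)" by (rule real_less_rsqrt) simp
  \<comment> \<open>This is \<open>4 * r < 1\<close>, the convergence of the binomial series at \<open>r\<close>.\<close>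
  have s5': "sqrt (5::real) < 9/4" by (rule real_less_lsqrt) (simp_all add: power2_eq_square)
  have r: "r > 0" "4 * r < 1" "r ^ 2 = 1 - 4 * r"
    using s5 s5' by (simp_all add: r_def power2_diff)
  have "(2 + sqrt 5) * r = 1" by (simp add: r_def algebra_simps)
  then have lr: "1 / (2 + sqrt 5) = r" using s5 by (metis nonzero_mult_div_cancel_left mult_zero_left zero_neq_one)
  define G where "G = Abs_fps N"
  define E where "E = fps_one_minus_4X_powr (1/2)"
  define D where "D = fps_one_minus_4X_powr (-1/2)"
  have G: "G = D + fps_X * D * G" unfolding D_def G_def by (rule renewal_fps)
  have ED: "E * D = 1" and EE: "E * E = 1 - 4 * fps_X"
    by (simp_all add: E_def D_def fps_one_minus_4X_powr_mult fps_one_minus_4X_powr_0 fps_one_minus_4X_powr_1)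
  have "E * G = E * (D + fps_X * D * G)"
    by (rule arg_cong[OF G])
  also have "\<dots> = E * D + fps_X * (E * D) * G"
    by (simp add: algebra_simps)
  finally have "E * G = E * D + fps_X * (E * D) * G" .
  then have EG: "E * G = 1 + fps_X * G" by (simp add: ED)
  have "(1 - 4 * fps_X) * G = E * (E * G)" by (simp only: EE[symmetric] mult.assoc)
  also have "\<dots> = E * (1 + fps_X * G)" by (simp only: EG)
  also have "\<dots> = E + fps_X * (E * G)" by (simp only: distrib_left mult_1_right mult.left_commute)
  also have "\<dots> = E + fps_X * (1 + fps_X * G)" by (simp only: EG)
  also have "\<dots> = E + fps_X + fps_X * (fps_X * G)" by (simp only: distrib_left mult_1_right add.assoc)
  finally have GE: "(1 - 4 * fps_X) * G = E + fps_X + fps_X * (fps_X * G)" .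
  define h where "h = (\<lambda>m. fps_nth (E + fps_X) m)"
  \<comment> \<open>The coefficients of \<open>(1 + r * X) * G\<close>, scaled by powers of \<open>r\<close>; they telescope to partial sums of \<open>h\<close> at \<open>r\<close>.\<close>
  define \<kappa> where "\<kappa> = (\<lambda>m. N (Suc m) * r ^ Suc m + r\<^sup>2 * (N m * r ^ m))"
  have N1: "N (Suc 0) = 4 * N 0 + h 1"
    using arg_cong[OF GE, of "\<lambda>f. fps_nth f 1"]
    by (simp add: h_def G_def algebra_simps numeral_fps_const fps_mult_left_const_nth)
  have N2: "N (Suc (Suc m)) = 4 * N (Suc m) + N m + h (Suc (Suc m))" for m
    using arg_cong[OF GE, of "\<lambda>f. fps_nth f (Suc (Suc m))"]
    by (simp add: h_def G_def algebra_simps numeral_fps_const fps_mult_left_const_nth)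
  have N0: "N 0 = h 0"
    using arg_cong[OF GE, of "\<lambda>f. fps_nth f 0"]
    by (simp add: h_def G_def)
  have \<kappa>: "\<kappa> m = (\<Sum>j<Suc (Suc m). h j * r ^ j)" for m
  proof (induction m)
    case 0
    have "4 * r * N 0 + r\<^sup>2 * N 0 = N 0" unfolding r(3) by (simp add: algebra_simps)
    then show ?case by (simp add: \<kappa>_def N1 N0 algebra_simps)
  next
    case (Suc m)
    have "\<kappa> (Suc m) - \<kappa> m = h (Suc (Suc m)) * r ^ Suc (Suc m) + (4 * r + r\<^sup>2 - 1) * (N (Suc m) * r ^ Suc m)"
      by (simp add: \<kappa>_def N2 algebra_simps power2_eq_square)
    then show ?case using Suc r(3) by simp
  qed
  have "(\<lambda>n. ((1/2) gchoose n) * (-4 * r) ^ n) sums (1 + (-4 * r)) powr (1/2)"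
    using r by (intro gen_binomial_real) auto
  also have "(1 + (-4 * r)) powr (1/2) = r" using r by (simp add: powr_half_sqrt flip: r(3))
  also have "(\<lambda>n. ((1/2) gchoose n) * (-4 * r) ^ n) = (\<lambda>n. fps_nth E n * r ^ n)"
    by (intro ext) (simp only: E_def fps_one_minus_4X_powr_def fps_nth_Abs_fps power_mult_distrib mult_ac)
  finally have "(\<lambda>n. fps_nth E n * r ^ n) sums r" .
  then have "(\<lambda>j. fps_nth E j * r ^ j + fps_nth fps_X j * r ^ j) sums (r + r)"
  proof (intro sums_add)
    show "(\<lambda>n. fps_nth fps_X n * r ^ n) sums r"
    proof -
      have "(\<lambda>n. fps_nth fps_X n * r ^ n) = (\<lambda>n. if n = 1 then r ^ n else 0)"
        by auto
      then show ?thesis using sums_single[of 1 "\<lambda>n. r ^ n"] by simp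
    qed
  qed
  then have "(\<lambda>j. h j * r ^ j) sums (2 * r)" by (simp add: h_def algebra_simps)
  then have "(\<lambda>m. \<Sum>j<Suc (Suc m). h j * r ^ j) \<longlonglongrightarrow> 2 * r"
    unfolding sums_def by (intro LIMSEQ_Suc)
  then have \<kappa>lim: "\<kappa> \<longlonglongrightarrow> 2 * r" by (simp add: \<kappa>[abs_def])
  have "(\<lambda>m. N m * r ^ m) \<longlonglongrightarrow> 2 * r / (1 + r\<^sup>2)"
  proof (rule tendsto_of_affine_recurrence[OF _ _ _ \<kappa>lim])
    show "N (Suc m) * r ^ Suc m = \<kappa> m - r\<^sup>2 * (N m * r ^ m)" for m by (simp add: \<kappa>_def)
  qed (use r in auto)
  moreover have "(\<lambda>m. N m * r ^ m) = (\<lambda>m. N m / (2 + sqrt 5) ^ m)"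
    by (intro ext) (simp add: power_one_over flip: lr)
  moreover have "2 * r / (1 + r\<^sup>2) > 0" using r by (intro divide_pos_pos) (auto intro: add_pos_nonneg)
  ultimately show ?thesis by auto
qed

end

section \<open>Asymptotics of Laguerre sums\<close>

abbreviation laguerre_sum :: "real \<Rightarrow> nat \<Rightarrow> real" where
  "laguerre_sum x n \<equiv> \<Sum>k\<le>n. real (n choose k) * x ^ k / fact k"

text \<open>
  The variance of a Poisson variable with mean \<open>\<mu>\<close>, multiplied by \<open>exp \<mu>\<close>.
\<close>
lemma exp_series_variance:
  fixes \<mu> :: real
  shows "(\<lambda>j. (real j - \<mu>)\<^sup>2 * (\<mu> ^ j / fact j)) sums (\<mu> * exp \<mu>)"
proof -
  have e: "(\<lambda>j. \<mu> ^ j / fact j) sums exp \<mu>"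
    using exp_converges[of \<mu>] by (simp add: field_simps)
  have 1: "(\<lambda>j. real j * (\<mu> ^ j / fact j)) sums (\<mu> * exp \<mu>)"
  proof -
    have "(\<lambda>j. real (Suc j) * (\<mu> ^ Suc j / fact (Suc j))) sums (\<mu> * exp \<mu>)"
      using sums_mult[OF e, of \<mu>] by (simp add: fact_Suc del: of_nat_Suc)
    from sums_Suc[OF this] show ?thesis by simp
  qed
  have 2: "(\<lambda>j. real j ^ 2 * (\<mu> ^ j / fact j)) sums (\<mu> * (\<mu> * exp \<mu> + exp \<mu>))"
  proof -
    have "(\<lambda>j. real (Suc j) ^ 2 * (\<mu> ^ Suc j / fact (Suc j))) sums (\<mu> * (\<mu> * exp \<mu> + exp \<mu>))"
    proof -
      have "(\<lambda>j. \<mu> * (real j * (\<mu> ^ j / fact j) + \<mu> ^ j / fact j)) sums (\<mu> * (\<mu> * exp \<mu> + exp \<mu>))"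
        by (intro sums_mult sums_add 1 e)
      also have "(\<lambda>j. \<mu> * (real j * (\<mu> ^ j / fact j) + \<mu> ^ j / fact j)) =
          (\<lambda>j. real (Suc j) ^ 2 * (\<mu> ^ Suc j / fact (Suc j)))"
      proof
        fix j
        have "real (Suc j) * (\<mu> ^ Suc j / fact (Suc j)) = \<mu> * (\<mu> ^ j / fact j)"
          by (simp add: fact_Suc del: of_nat_Suc)
        then have "real (Suc j) ^ 2 * (\<mu> ^ Suc j / fact (Suc j)) = real (Suc j) * (\<mu> * (\<mu> ^ j / fact j))"
          by (metis power2_eq_square mult.assoc)
        moreover have "\<mu> * (real j * (\<mu> ^ j / fact j) + \<mu> ^ j / fact j) =
            real (Suc j) * (\<mu> * (\<mu> ^ j / fact j))"
          by (simp add: algebra_simps add_divide_distrib)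
        ultimately show "\<mu> * (real j * (\<mu> ^ j / fact j) + \<mu> ^ j / fact j) =
            real (Suc j) ^ 2 * (\<mu> ^ Suc j / fact (Suc j))"
          by (simp only:)
      qed
      finally show ?thesis .
    qed
    from sums_Suc[OF this] show ?thesis by simp
  qed
  have "(\<lambda>j. real j ^ 2 * (\<mu> ^ j / fact j) - 2 * \<mu> * (real j * (\<mu> ^ j / fact j)) + \<mu>\<^sup>2 * (\<mu> ^ j / fact j))
      sums (\<mu> * (\<mu> * exp \<mu> + exp \<mu>) - 2 * \<mu> * (\<mu> * exp \<mu>) + \<mu>\<^sup>2 * exp \<mu>)"
    by (intro sums_add sums_diff sums_mult 1 2 e)
  then show ?thesis
    by (simp add: power2_eq_square algebra_simps)
qed

text \<open>
  Chebyshev's inequality for a Poisson variable of mean \<open>\<mu>\<close>, seen on its even values \<open>2k\<close>. The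
  total weight of the even values is \<open>cosh \<mu>\<close>. Outside the window of relative width \<open>\<delta>\<close> the factor
  \<open>(2k - \<mu>)\<^sup>2 / (\<delta> \<mu>)\<^sup>2\<close> is at least \<open>1\<close>, so that \<open>\<epsilon> + B (2k - \<mu>)\<^sup>2 / (\<delta> \<mu>)\<^sup>2\<close> bounds the deviation of \<open>h k\<close> from
  \<open>L\<close> for every \<open>k\<close>; summed over all values, even or odd, this bound gives the claim.
\<close>
lemma even_poisson_concentration:
  fixes \<mu> :: real and h :: "nat \<Rightarrow> real"
  assumes \<mu>: "\<mu> > 0" and \<delta>: "\<delta> > 0" and \<epsilon>: "\<epsilon> \<ge> 0" and B: "\<And>k. \<bar>h k - L\<bar> \<le> B"
    and near: "\<And>k. \<bar>2 * real k - \<mu>\<bar> \<le> \<delta> * \<mu> \<Longrightarrow> \<bar>h k - L\<bar> \<le> \<epsilon>"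
    and S: "(\<lambda>k. h k * (\<mu> ^ (2 * k) / fact (2 * k))) sums S"
  shows "\<bar>S - L * cosh \<mu>\<bar> \<le> (\<epsilon> + B / (\<delta>\<^sup>2 * \<mu>)) * exp \<mu>"
proof -
  define w where "w = (\<lambda>j. \<mu> ^ j / fact j)"
  have w0: "w j \<ge> 0" for j unfolding w_def using \<mu> by simp
  have B0: "B \<ge> 0" using B[of 0] by linarith
  have "(\<lambda>j. if even j then h (j div 2) * w j else 0) sums S"
  proof -
    have "(\<lambda>k. (\<lambda>j. if even j then h (j div 2) * w j else 0) (2 * k)) sums S"
      using S by (simp add: w_def)
    then show ?thesis
      by (subst (asm) sums_mono_reindex) (auto simp: strict_mono_def elim!: evenE)
  qed
  moreover have "(\<lambda>j. if even j then w j else 0) sums cosh \<mu>"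
  proof -
    have "(\<lambda>n. if even n then w n else 0) = (\<lambda>n. if even n then \<mu> ^ n /\<^sub>R fact n else 0)"
      by (auto simp: w_def field_simps)
    then show ?thesis using cosh_converges[of \<mu>] by simp
  qed
  ultimately have d: "(\<lambda>j. (if even j then h (j div 2) * w j else 0) - L * (if even j then w j else 0))
      sums (S - L * cosh \<mu>)"
    by (intro sums_diff sums_mult)
  have e: "w sums exp \<mu>"
    using exp_converges[of \<mu>] by (simp add: w_def field_simps)
  have m: "(\<lambda>j. \<epsilon> * w j + B / (\<delta> * \<mu>)\<^sup>2 * ((real j - \<mu>)\<^sup>2 * w j)) sums
      (\<epsilon> * exp \<mu> + B / (\<delta> * \<mu>)\<^sup>2 * (\<mu> * exp \<mu>))"
    using exp_series_variance[of \<mu>] by (intro sums_add sums_mult e) (simp add: w_def)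
  have le: "\<bar>(if even j then h (j div 2) * w j else 0) - L * (if even j then w j else 0)\<bar>
      \<le> \<epsilon> * w j + B / (\<delta> * \<mu>)\<^sup>2 * ((real j - \<mu>)\<^sup>2 * w j)" for j
  proof (cases "even j")
    case True
    then obtain k where k: "j = 2 * k" by blast
    have "\<bar>h k - L\<bar> \<le> \<epsilon> + B / (\<delta> * \<mu>)\<^sup>2 * (real j - \<mu>)\<^sup>2"
    proof (cases "\<bar>2 * real k - \<mu>\<bar> \<le> \<delta> * \<mu>")
      case True
      have "\<bar>h k - L\<bar> \<le> \<epsilon>" by (rule near[OF True])
      moreover have "0 \<le> B / (\<delta> * \<mu>)\<^sup>2 * (real j - \<mu>)\<^sup>2" using B0 by simp
      ultimately show ?thesis by linarith
    next
      case False
      have "(\<delta> * \<mu>)\<^sup>2 \<le> \<bar>real j - \<mu>\<bar>\<^sup>2"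
        using False \<delta> \<mu> k by (intro power_mono) auto
      then have "B * 1 \<le> B * ((real j - \<mu>)\<^sup>2 / (\<delta> * \<mu>)\<^sup>2)"
        using \<delta> \<mu> by (intro mult_left_mono B0) (simp add: divide_simps)
      then show ?thesis using B[of k] \<epsilon> by simp
    qed
    then have "\<bar>h k - L\<bar> * w j \<le> (\<epsilon> + B / (\<delta> * \<mu>)\<^sup>2 * (real j - \<mu>)\<^sup>2) * w j"
      by (intro mult_right_mono w0)
    moreover have "\<bar>h k - L\<bar> * w j = \<bar>h k * w j - L * w j\<bar>"
      using w0[of j] by (simp add: abs_mult left_diff_distrib[symmetric])
    ultimately show ?thesis using k by (simp add: algebra_simps)
  next
    case False
    then show ?thesis using w0[of j] \<epsilon> B0 by simp
  qed
  have "\<bar>S - L * cosh \<mu>\<bar> \<le> \<epsilon> * exp \<mu> + B / (\<delta> * \<mu>)\<^sup>2 * (\<mu> * exp \<mu>)"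
  proof -
    have "norm (suminf (\<lambda>j. (if even j then h (j div 2) * w j else 0) - L * (if even j then w j else 0)))
       \<le> suminf (\<lambda>j. \<epsilon> * w j + B / (\<delta> * \<mu>)\<^sup>2 * ((real j - \<mu>)\<^sup>2 * w j))"
      using le m by (intro norm_suminf_le) (auto simp: sums_iff)
    then show ?thesis using d m by (simp add: sums_iff)
  qed
  also have "\<dots> = (\<epsilon> + B / (\<delta>\<^sup>2 * \<mu>)) * exp \<mu>"
    using \<mu> \<delta> by (simp add: field_simps power2_eq_square)
  finally show ?thesis .
qed

text \<open>
  The general asymptotics of \<open>a gchoose n\<close> for \<open>a = - 1 / 2\<close>, where \<open>Gamma (1 / 2) = sqrt pi\<close>
  supplies the constant.
\<close>
lemma central_binomial_limit:
  "(\<lambda>k. real ((2 * k) choose k) / 4 ^ k * sqrt (real k)) \<longlonglongrightarrow> 1 / sqrt pi"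
proof -
  have "(\<lambda>n. ((- 1 / 2 :: real) gchoose n) / ((-1)^n / exp ((- 1 / 2 + 1) * of_real (ln (real n)))))
      \<longlonglongrightarrow> inverse (Gamma (- (- 1 / 2 :: real)))"
    by (rule gbinomial_asymptotic)
  then have "(\<lambda>n. ((- 1 / 2 :: real) gchoose n) / ((-1)^n / exp ((- 1 / 2 + 1) * of_real (ln (real n)))))
      \<longlonglongrightarrow> 1 / sqrt pi"
    by (simp add: Gamma_one_half_real inverse_eq_divide)
  moreover have "\<forall>\<^sub>F n in sequentially.
      ((- 1 / 2 :: real) gchoose n) / ((-1)^n / exp ((- 1 / 2 + 1) * of_real (ln (real n)))) =
      real ((2 * n) choose n) / 4 ^ n * sqrt (real n)"
    using eventually_gt_at_top[of "0::nat"]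
  proof eventually_elim
    case (elim n)
    have "exp (ln (real n) / 2) = sqrt (real n)"
      using elim by (simp add: powr_half_sqrt[symmetric] powr_def)
    moreover have "real ((2 * n) choose n) / 4 ^ n = (-1) ^ n * ((- 1 / 2 :: real) gchoose n)"
      unfolding gbinomial_minus_half[symmetric] by (simp add: power_mult_distrib[symmetric] flip: power_divide) (simp add: field_simps flip: power_mult_distrib)
    ultimately show ?case by (cases "even n") auto
  qed
  ultimately show ?thesis by (rule Lim_transform_eventually)
qed

text \<open>
  The product is \<open>k! (n choose k) / n ^ k\<close>. For \<open>k\<close> of order \<open>sqrt n\<close> its logarithm is
  \<open>- k\<^sup>2 / (2 n)\<close> up to \<open>o(1)\<close>; this and the next lemma bound it from both sides.
\<close>
lemma falling_prod_le_exp: 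
  assumes "k \<le> n" 
  shows "(\<Prod>j<k. 1 - real j / real n) \<le> exp (- (real k * (real k - 1) / (2 * real n)))"
proof -
  have "(\<Prod>j<k. 1 - real j / real n) \<le> (\<Prod>j<k. exp (- (real j / real n)))"
  proof (intro prod_mono conjI)
    fix j assume "j \<in> {..<k}"
    then show "0 \<le> 1 - real j / real n" using assms by (simp add: divide_simps)
    show "1 - real j / real n \<le> exp (- (real j / real n))"
      using exp_ge_add_one_self[of "- (real j / real n)"] by simp
  qed
  also have "\<dots> = exp (- (\<Sum>j<k. real j) / real n)"
    by (simp flip: exp_sum add: sum_negf sum_divide_distrib)
  also have "(\<Sum>j<k. real j) = real k * (real k - 1) / 2"
    by (induction k) (auto simp: field_simps)
  finally show ?thesis by simp
qed

lemma exp_le_falling_prod: 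
  assumes "2 * k \<le> n" 
  shows "exp (- (real k * (real k - 1) / (2 * real n)) - 2 * (real k ^ 3 / real n ^ 2)) \<le> (\<Prod>j<k. 1 - real j / real n)"
proof -
  have "exp (- (real k * (real k - 1) / (2 * real n)) - 2 * (real k ^ 3 / real n ^ 2)) \<le> 
    exp (- (\<Sum>j<k. real j) / real n - 2 * (\<Sum>j<k. (real j / real n)\<^sup>2))"
  proof -
    have "(\<Sum>j<k. (real j / real n)\<^sup>2) \<le> (\<Sum>j<k. (real k / real n)\<^sup>2)"
      by (intro sum_mono power_mono divide_right_mono) auto
    also have "\<dots> = real k ^ 3 / real n ^ 2"
      by (simp add: power_divide power3_eq_cube power2_eq_square)
    finally have "(\<Sum>j<k. (real j / real n)\<^sup>2) \<le> real k ^ 3 / real n ^ 2" .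
    moreover have "(\<Sum>j<k. real j) / real n = real k * (real k - 1) / (2 * real n)"
    proof -
      have "(\<Sum>j<k. real j) = real k * (real k - 1) / 2"
        by (induction k) (auto simp: field_simps)
      then show ?thesis by (simp only: divide_divide_eq_left)
    qed
    ultimately show ?thesis by simp
  qed
  also have "\<dots> = (\<Prod>j<k. exp (- (real j / real n) - 2 * (real j / real n)\<^sup>2))"
    by (simp flip: exp_sum add: sum_negf sum_divide_distrib sum_subtractf sum_distrib_left)
  also have "\<dots> \<le> (\<Prod>j<k. 1 - real j / real n)"
  proof (intro prod_mono conjI)
    fix j assume "j \<in> {..<k}"
    then have j: "real j / real n \<le> 1 / 2" using assms by (simp add: divide_simps)
    then have "- (real j / real n) - 2 * (real j / real n)\<^sup>2 \<le> ln (1 - real j / real n)"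
      using ln_one_minus_pos_lower_bound[of "real j / real n"] by simp
    then show "exp (- (real j / real n) - 2 * (real j / real n)\<^sup>2) \<le> 1 - real j / real n"
    proof (subst ln_ge_iff[symmetric])
      show "0 < 1 - real j / real n" using j by linarith
    qed
  qed auto
  finally show ?thesis .
qed

text \<open>
  The filter of pairs \<open>(n, k)\<close> with \<open>n \<rightarrow> \<infinity>\<close> and \<open>k / sqrt (x n) \<rightarrow> 1\<close>. Convergence along this filter is
  uniform over small relative windows around \<open>sqrt (x n)\<close>, where the Poisson weights concentrate, and
  the calculus of limits applies to it directly.
\<close>
definition sqrt_scale :: "real \<Rightarrow> (nat \<times> nat) filter" where
  "sqrt_scale x = inf (filtercomap fst at_top)
     (filtercomap (\<lambda>p. real (snd p) / sqrt (x * real (fst p))) (nhds 1))"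

text \<open>
  Along the filter \<open>k\<^sup>2 / (2 n) \<rightarrow> x / 2\<close>, which produces the factor \<open>exp (- x / 2)\<close>, and
  \<open>(2 k choose k) / 4 ^ k\<close> behaves like \<open>1 / sqrt (pi k)\<close> with \<open>k\<close> close to \<open>sqrt (x n)\<close>.
\<close>
lemma even_poisson_weight_limit:
  assumes x: "x > 0"
  shows "((\<lambda>(n, k). sqrt (sqrt (x * real n)) * ((\<Prod>j<k. 1 - real j / real n) * (real ((2 * k) choose k) / 4 ^ k)))
     \<longlongrightarrow> exp (- x / 2) / sqrt pi) (sqrt_scale x)"
proof -
  define F where "F = sqrt_scale x"
  define z where "z = (\<lambda>p::nat \<times> nat. sqrt (x * real (fst p)))"
  define t where "t = (\<lambda>p. real (snd p) / z p)"
  have n: "filterlim fst at_top F"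
    unfolding F_def sqrt_scale_def filterlim_iff_le_filtercomap by simp
  have t: "(t \<longlongrightarrow> 1) F"
    unfolding F_def sqrt_scale_def t_def z_def filterlim_iff_le_filtercomap by simp
  have z: "filterlim z at_top F"
    unfolding z_def
    by (intro filterlim_compose[OF sqrt_at_top] filterlim_tendsto_pos_mult_at_top[OF tendsto_const x]
        filterlim_compose[OF filterlim_real_sequentially n])
  have z0: "\<forall>\<^sub>F p in F. z p > 0"
    using z by (simp add: filterlim_at_top_dense)
  have "filterlim (\<lambda>p. t p * z p) at_top F"
    by (rule filterlim_tendsto_pos_mult_at_top[OF t _ z]) simp
  moreover have tz: "\<forall>\<^sub>F p in F. t p * z p = real (snd p)"
    using z0 by eventually_elim (simp add: t_def)
  ultimately have "filterlim (\<lambda>p. real (snd p)) at_top F"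
    by (simp add: filterlim_cong[OF refl refl tz])
  then have k: "filterlim snd at_top F"
    unfolding filterlim_at_top by (metis (mono_tags, lifting) eventually_mono of_nat_le_iff)
  have cb: "((\<lambda>p. real ((2 * snd p) choose snd p) / 4 ^ snd p * sqrt (real (snd p))) \<longlongrightarrow> 1 / sqrt pi) F"
    by (rule filterlim_compose[OF central_binomial_limit k])
  have iz: "((\<lambda>p. 1 / z p) \<longlongrightarrow> 0) F"
    using z by (intro tendsto_divide_0[OF tendsto_const]) (simp add: filterlim_at_top_imp_at_infinity)
  have a: "((\<lambda>p. x * (t p ^ 2 - t p * (1 / z p)) / 2) \<longlongrightarrow> x * (1 ^ 2 - 1 * 0) / 2) F"
    by (intro tendsto_intros t iz) auto
  have b: "((\<lambda>p. x ^ 2 * (t p ^ 3 * (1 / z p))) \<longlongrightarrow> x ^ 2 * (1 ^ 3 * 0)) F"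
    by (intro tendsto_intros t iz)
  have ab: "\<forall>\<^sub>F p in F. x * (t p ^ 2 - t p * (1 / z p)) / 2 = real (snd p) * (real (snd p) - 1) / (2 * real (fst p)) \<and>
      x ^ 2 * (t p ^ 3 * (1 / z p)) = real (snd p) ^ 3 / real (fst p) ^ 2"
    using z0
  proof eventually_elim
    case (elim p)
    have sq: "z p ^ 2 = x * real (fst p)" using x by (simp add: z_def)
    then have fp: "real (fst p) = z p ^ 2 / x" using x by (simp add: field_simps)
    show ?case unfolding fp t_def using elim x
      by (simp add: field_simps power2_eq_square power3_eq_cube)
  qed
  have small: "\<forall>\<^sub>F p in F. 2 * snd p \<le> fst p"
  proof -
    have "((\<lambda>p. x * t p * (1 / z p)) \<longlongrightarrow> x * 1 * 0) F" by (intro tendsto_intros t iz)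
    then have "\<forall>\<^sub>F p in F. x * t p * (1 / z p) < 1 / 2" by (rule order_tendstoD) simp
    with z0 show ?thesis
    proof eventually_elim
      case (elim p)
      have sq: "z p * z p = x * real (fst p)" using x by (simp add: z_def)
      have "x * (real (snd p) / (x * real (fst p))) < 1 / 2"
        using elim unfolding t_def sq[symmetric] by simp
      moreover have "real (fst p) > 0" using elim x by (auto simp: z_def zero_less_mult_iff)
      ultimately have "2 * real (snd p) < real (fst p)" using x by (simp add: field_simps)
      then show ?case by linarith
    qed
  qed
  have fp: "((\<lambda>p. \<Prod>j<snd p. 1 - real j / real (fst p)) \<longlongrightarrow> exp (- x / 2)) F"
  proof (rule tendsto_sandwich)
    show "\<forall>\<^sub>F p in F. exp (- (x * (t p ^ 2 - t p * (1 / z p)) / 2) - 2 * (x ^ 2 * (t p ^ 3 * (1 / z p))))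
        \<le> (\<Prod>j<snd p. 1 - real j / real (fst p))"
      using ab small
    proof eventually_elim
      case (elim p)
      from exp_le_falling_prod[OF elim(2)] show ?case
        unfolding conjunct1[OF elim(1)] conjunct2[OF elim(1)] .
    qed
    show "\<forall>\<^sub>F p in F. (\<Prod>j<snd p. 1 - real j / real (fst p)) \<le> exp (- (x * (t p ^ 2 - t p * (1 / z p)) / 2))"
      using ab small
    proof eventually_elim
      case (elim p)
      from elim(2) have "snd p \<le> fst p" by simp
      from falling_prod_le_exp[OF this] show ?case
        unfolding conjunct1[OF elim(1)] .
    qed
    show "((\<lambda>p. exp (- (x * (t p ^ 2 - t p * (1 / z p)) / 2) - 2 * (x ^ 2 * (t p ^ 3 * (1 / z p))))) \<longlongrightarrow> exp (- x / 2)) F"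
      using tendsto_exp[OF tendsto_diff[OF tendsto_minus[OF a] tendsto_mult[OF tendsto_const[of 2] b]]] by simp
    show "((\<lambda>p. exp (- (x * (t p ^ 2 - t p * (1 / z p)) / 2))) \<longlongrightarrow> exp (- x / 2)) F"
      using tendsto_exp[OF tendsto_minus[OF a]] by simp
  qed
  have "((\<lambda>p. (1 / sqrt (t p)) * ((\<Prod>j<snd p. 1 - real j / real (fst p)) *
      (real ((2 * snd p) choose snd p) / 4 ^ snd p * sqrt (real (snd p))))) \<longlongrightarrow>
      (1 / sqrt 1) * (exp (- x / 2) * (1 / sqrt pi))) F"
    by (intro tendsto_intros t fp cb) auto
  moreover have "\<forall>\<^sub>F p in F. (1 / sqrt (t p)) * ((\<Prod>j<snd p. 1 - real j / real (fst p)) *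
      (real ((2 * snd p) choose snd p) / 4 ^ snd p * sqrt (real (snd p)))) =
     sqrt (z p) * ((\<Prod>j<snd p. 1 - real j / real (fst p)) * (real ((2 * snd p) choose snd p) / 4 ^ snd p))"
    using z0 filterlim_at_top[THEN iffD1, OF k, rule_format, of 1]
  proof eventually_elim
    case (elim p)
    then have "1 / sqrt (t p) * sqrt (real (snd p)) = sqrt (z p)"
      by (simp add: t_def real_sqrt_divide)
    moreover have "1 / T * (P * (B * K)) = (1 / T * K) * (P * B)" for T P B K :: real
      by simp
    ultimately show ?case by (simp only:)
  qed
  ultimately have "((\<lambda>p. sqrt (z p) * ((\<Prod>j<snd p. 1 - real j / real (fst p)) * (real ((2 * snd p) choose snd p) / 4 ^ snd p)))
      \<longlongrightarrow> exp (- x / 2) / sqrt pi) F"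
    by (simp add: Lim_transform_eventually)
  then show ?thesis
    unfolding F_def z_def case_prod_unfold .
qed

text \<open>
  Perron's formula for the Laguerre polynomials \<open>L\<^sub>n(- x)\<close>. With \<open>z = sqrt (x n)\<close>
  the term \<open>(n choose k) x ^ k / k!\<close> equals \<open>g(n, k) (2 z) ^ (2 k) / (2 k)!\<close>, where \<open>g(n, k) = (\<Prod>j<k. 1 - j / n) (2 k choose k) / 4 ^ k\<close> is a slowly varying weight. The
  error term of Chebyshev's inequality is of order \<open>1 / z\<close>, which beats the crude bound \<open>sqrt z\<close> on the
  rescaled weight.
\<close>
lemma laguerre_asymp:
  assumes x: "x > 0"
  shows "(\<lambda>n. \<Sum>k\<le>n. real (n choose k) * x ^ k / fact k) \<sim>[at_top]
    (\<lambda>n. exp (- x / 2) / (2 * sqrt pi) * (exp (2 * sqrt (x * real n)) / sqrt (sqrt (x * real n))))"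
proof -
  define S where "S = (\<lambda>n. \<Sum>k\<le>n. real (n choose k) * x ^ k / fact k)"
  define z where "z = (\<lambda>n. sqrt (x * real n))"
  define g where "g = (\<lambda>n k. (\<Prod>j<k. 1 - real j / real n) * (real ((2 * k) choose k) / 4 ^ k))"
  define L where "L = exp (- x / 2) / sqrt pi"
  have L: "L > 0" unfolding L_def by simp
  have z: "filterlim z at_top at_top"
    unfolding z_def
    by (intro filterlim_compose[OF sqrt_at_top] filterlim_tendsto_pos_mult_at_top[OF tendsto_const x]
        filterlim_real_sequentially)
  have g0: "g n k \<ge> 0" and g1: "g n k \<le> 1" and gn: "k > n \<Longrightarrow> g n k = 0" if n: "n > 0" for n k
  proof -
    have P: "(\<Prod>j<k. 1 - real j / real n) = 0" if "k > n"
      using that n by (intro prod_zero) auto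
    then show "k > n \<Longrightarrow> g n k = 0" by (simp add: g_def)
    have P01: "0 \<le> (\<Prod>j<k. 1 - real j / real n) \<and> (\<Prod>j<k. 1 - real j / real n) \<le> 1"
    proof (cases "k > n")
      case False
      then show ?thesis using n by (intro conjI prod_nonneg prod_le_1) (auto simp: divide_simps)
    qed (simp add: P)
    have "(2 * k) choose k \<le> 2 ^ (2 * k)" by (rule binomial_le_pow2)
    then have "real ((2 * k) choose k) \<le> 4 ^ k" 
      by (metis (mono_tags, lifting) of_nat_le_iff of_nat_power power_mult of_nat_numeral power2_eq_square num_double numeral_times_numeral)
    then have c: "real ((2 * k) choose k) / 4 ^ k \<le> 1" by simp
    show "g n k \<ge> 0" unfolding g_def using P01 by simp
    show "g n k \<le> 1" unfolding g_def by (intro mult_le_one c) (use P01 in auto)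
  qed
  have trm: "real (n choose k) * x ^ k / fact k = g n k * ((2 * z n) ^ (2 * k) / fact (2 * k))" if n: "n > 0" and k: "k \<le> n" for n k
  proof -
    have "(\<Prod>j<k. 1 - real j / real n) = (\<Prod>j<k. (real n - real j) / real n)"
      using n by (intro prod.cong) (auto simp: field_simps)
    also have "\<dots> = (\<Prod>j<k. real n - real j) / real n ^ k" by (simp add: prod_dividef)
    also have "(\<Prod>j<k. real n - real j) = fact k * real (n choose k)"
      by (simp add: binomial_gbinomial gbinomial_prod_rev lessThan_atLeast0)
    finally have 1: "(\<Prod>j<k. 1 - real j / real n) = fact k * real (n choose k) / real n ^ k" .
    have 2: "real ((2 * k) choose k) = fact (2 * k) / (fact k * fact k)"
      by (subst binomial_fact) (simp_all del: fact_Suc)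
    have 3: "(2 * z n) ^ (2 * k) = 4 ^ k * (x ^ k * real n ^ k)"
      using x by (simp add: power_mult z_def power_mult_distrib)
    show ?thesis unfolding g_def 1 2 3 using n by simp
  qed
  have Ssums: "(\<lambda>k. g n k * ((2 * z n) ^ (2 * k) / fact (2 * k))) sums S n" if n: "n > 0" for n
  proof -
    have "(\<lambda>k. g n k * ((2 * z n) ^ (2 * k) / fact (2 * k))) sums
       (\<Sum>k\<le>n. g n k * ((2 * z n) ^ (2 * k) / fact (2 * k)))"
      using gn[OF n] by (intro sums_finite) auto
    also have "(\<Sum>k\<le>n. g n k * ((2 * z n) ^ (2 * k) / fact (2 * k))) = S n"
      unfolding S_def by (intro sum.cong refl) (simp add: trm[OF n])
    finally show ?thesis .
  qed
  have lim: "(\<lambda>n. (sqrt (z n) * S n - L * cosh (2 * z n)) / exp (2 * z n)) \<longlonglongrightarrow> 0"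
    unfolding tendsto_iff
  proof (intro allI impI)
    fix e :: real assume e: "e > 0"
    have "\<forall>\<^sub>F p in sqrt_scale x. \<bar>sqrt (z (fst p)) * g (fst p) (snd p) - L\<bar> < e / 2"
      using tendstoD[OF even_poisson_weight_limit[OF x] half_gt_zero[OF e]]
      unfolding z_def g_def L_def dist_real_def case_prod_unfold .
    then obtain Q1 Q2 where Q1: "eventually Q1 (filtercomap fst at_top)"
      and Q2: "eventually Q2 (filtercomap (\<lambda>p. real (snd p) / sqrt (x * real (fst p))) (nhds 1))"
      and Q: "\<And>p. Q1 p \<Longrightarrow> Q2 p \<Longrightarrow> \<bar>sqrt (z (fst p)) * g (fst p) (snd p) - L\<bar> < e / 2"
      unfolding sqrt_scale_def eventually_inf by blast
    from Q1 obtain N where N: "\<And>p. fst p \<ge> N \<Longrightarrow> Q1 p"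
      unfolding eventually_filtercomap eventually_at_top_linorder by blast
    from Q2 obtain d where d: "d > 0" and Q2d: "\<And>p. dist (real (snd p) / z (fst p)) 1 < d \<Longrightarrow> Q2 p"
      unfolding eventually_filtercomap eventually_nhds_metric z_def by blast
    \<comment> \<open>The metric neighbourhood is open, the window of the concentration lemma closed, hence a smaller radius.\<close>
    define c where "c = d / 2"
    have c: "c > 0" using d by (simp add: c_def)
    have near: "\<bar>sqrt (z n) * g n k - L\<bar> \<le> e / 2"
      if "n \<ge> N" "z n > 0" "\<bar>2 * real k - 2 * z n\<bar> \<le> c * (2 * z n)" for n k
    proof -
      have "dist (real k / z n) 1 = \<bar>real k - z n\<bar> / z n"
        using that(2) by (simp add: dist_real_def field_simps)
      also have "\<dots> \<le> c" using that(2,3) by (simp add: field_simps)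
      also have "c < d" using d by (simp add: c_def)
      finally show ?thesis using Q[of "(n, k)"] Q2d[of "(n, k)"] N[of "(n, k)"] that(1) by simp
    qed
    have "((\<lambda>n. (1 / sqrt (z n) + L * (1 / z n)) / (2 * c\<^sup>2)) \<longlongrightarrow> (0 + L * 0) / (2 * c\<^sup>2)) at_top"
    proof (intro tendsto_intros)
      show "((\<lambda>n. 1 / z n) \<longlongrightarrow> 0) at_top"
        using z by (intro tendsto_divide_0[OF tendsto_const]) (simp add: filterlim_at_top_imp_at_infinity)
      show "((\<lambda>n. 1 / sqrt (z n)) \<longlongrightarrow> 0) at_top"
        using filterlim_compose[OF sqrt_at_top z]
        by (intro tendsto_divide_0[OF tendsto_const]) (simp add: filterlim_at_top_imp_at_infinity)
    qed (use c in auto)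
    then have "\<forall>\<^sub>F n in at_top. (1 / sqrt (z n) + L * (1 / z n)) / (2 * c\<^sup>2) < e / 2"
      using e by (intro order_tendstoD(2)) auto
    moreover have "\<forall>\<^sub>F n in at_top. z n > 0" using z by (simp add: filterlim_at_top_dense)
    ultimately show "\<forall>\<^sub>F n in at_top. dist ((sqrt (z n) * S n - L * cosh (2 * z n)) / exp (2 * z n)) 0 < e"
      using eventually_ge_at_top[of N] eventually_gt_at_top[of 0]
    proof eventually_elim
      case (elim n)
      have "\<bar>sqrt (z n) * S n - L * cosh (2 * z n)\<bar> \<le> (e / 2 + (sqrt (z n) + L) / (c\<^sup>2 * (2 * z n))) * exp (2 * z n)"
      proof (rule even_poisson_concentration[where h = "\<lambda>k. sqrt (z n) * g n k"])
        show "\<bar>sqrt (z n) * g n k - L\<bar> \<le> sqrt (z n) + L" for k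
        proof -
          have "sqrt (z n) * g n k \<le> sqrt (z n) * 1" "0 \<le> sqrt (z n) * g n k"
            using elim by (intro mult_left_mono g1 mult_nonneg_nonneg g0; simp)+
          then show ?thesis using L by linarith
        qed
        show "\<bar>sqrt (z n) * g n k - L\<bar> \<le> e / 2" if "\<bar>2 * real k - 2 * z n\<bar> \<le> c * (2 * z n)" for k
          using near[OF elim(3,2) that] .
        show "(\<lambda>k. sqrt (z n) * g n k * ((2 * z n) ^ (2 * k) / fact (2 * k))) sums (sqrt (z n) * S n)"
          using sums_mult[OF Ssums[OF elim(4)], of "sqrt (z n)"] by (simp add: mult.assoc)
      qed (use elim c e in auto)
      also have "(sqrt (z n) + L) / (c\<^sup>2 * (2 * z n)) = (1 / sqrt (z n) + L * (1 / z n)) / (2 * c\<^sup>2)"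
      proof -
        have "sqrt (z n) / z n = 1 / sqrt (z n)" using elim by (simp add: real_div_sqrt field_simps)
        then have "(sqrt (z n) + L) / z n = 1 / sqrt (z n) + L * (1 / z n)" by (simp add: add_divide_distrib)
        then show ?thesis by (metis divide_divide_eq_left mult.commute mult.assoc)
      qed
      also have "(e / 2 + \<dots>) * exp (2 * z n) < (e / 2 + e / 2) * exp (2 * z n)"
        using elim by (intro mult_strict_right_mono add_strict_left_mono) auto
      finally show ?case by (simp add: dist_real_def divide_simps)
    qed
  qed
  have cosh: "(\<lambda>n. L * (cosh (2 * z n) / exp (2 * z n))) \<longlonglongrightarrow> L * (1 / 2)"
  proof (rule tendsto_mult[OF tendsto_const])
    have "((\<lambda>y::real. cosh y / exp y) \<longlongrightarrow> 1 / 2) at_top"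
      unfolding cosh_field_def by real_asymp
    moreover have "filterlim (\<lambda>n. 2 * z n) at_top at_top"
      by (rule filterlim_tendsto_pos_mult_at_top[OF tendsto_const _ z]) simp
    ultimately show "(\<lambda>n. cosh (2 * z n) / exp (2 * z n)) \<longlonglongrightarrow> 1 / 2"
      by (rule filterlim_compose)
  qed
  have "(\<lambda>n. sqrt (z n) * S n / exp (2 * z n)) \<longlonglongrightarrow> L / 2"
    using tendsto_add[OF lim cosh] by (simp add: diff_divide_distrib)
  then have "(\<lambda>n. (sqrt (z n) * S n / exp (2 * z n)) / (L / 2)) \<longlonglongrightarrow> 1"
    using L tendsto_divide[OF _ tendsto_const[of "L/2"]] by fastforce
  moreover have "\<forall>\<^sub>F n in at_top. z n > 0" using z by (simp add: filterlim_at_top_dense)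
  then have "\<forall>\<^sub>F n in at_top. (sqrt (z n) * S n / exp (2 * z n)) / (L / 2) = S n / (exp (- x / 2) / (2 * sqrt pi) * (exp (2 * z n) / sqrt (z n)))"
    by eventually_elim (simp add: L_def mult_ac)
  ultimately have "(\<lambda>n. S n / (exp (- x / 2) / (2 * sqrt pi) * (exp (2 * z n) / sqrt (z n)))) \<longlonglongrightarrow> 1"
    by (rule Lim_transform_eventually)
  then show ?thesis
    unfolding S_def z_def by (rule asymp_equivI')
qed

section \<open>Moments under an arbitrary second permutation\<close>

text \<open>
  For each fixed value \<open>r\<close> of the second permutation, \<open>p \<mapsto> inv r \<circ> p\<close> is a bijection of the
  symmetric group and preserves the uniform law. The average over the first permutation therefore
  does not depend on \<open>r\<close>, and the law of the second one drops out.
\<close>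
lemma uniform_indep_perms_expectation:
  assumes U: "uniform_indep_perms n M P R" and n: "n \<ge> 1"
    and inv: "\<And>p r. p permutes {1..n} \<Longrightarrow> r permutes {1..n} \<Longrightarrow> f p r = g (inv r \<circ> p)"
  shows "integrable M (\<lambda>\<omega>. f (P \<omega>) (R \<omega>) :: real)"
    and "integral\<^sup>L M (\<lambda>\<omega>. f (P \<omega>) (R \<omega>)) = (\<Sum>\<sigma> | \<sigma> permutes {1..n}. g \<sigma>) / fact n"
proof -
  let ?\<Pi> = "{p. p permutes {1..n}}"
  interpret prob_space M using U by (simp add: uniform_indep_perms_def)
  have fin: "finite ?\<Pi>" by (simp add: finite_permutations)
  have cardP: "card ?\<Pi> = fact n" by (rule card_permutations) auto
  have iv: "indep_var (perm_space n) P (perm_space n) R" using U by (simp add: uniform_indep_perms_def)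
  have P: "P \<in> measurable M (perm_space n)" and R: "R \<in> measurable M (perm_space n)"
    using indep_var_rv1[OF iv] indep_var_rv2[OF iv] by auto
  have Psp: "P \<omega> permutes {1..n}" and Rsp: "R \<omega> permutes {1..n}" if "\<omega> \<in> space M" for \<omega>
    using measurable_space[OF P that] measurable_space[OF R that] by auto
  define A where "A = (\<lambda>p r. (\<lambda>\<omega>. (P \<omega>, R \<omega>)) -` ({p} \<times> {r}) \<inter> space M)"
  define q where "q = (\<lambda>r. prob (R -` {r} \<inter> space M))"
  have Aeq: "A p r = (P -` {p} \<inter> space M) \<inter> (R -` {r} \<inter> space M)" for p r
    unfolding A_def by auto
  have A: "A p r \<in> events" if "p \<in> ?\<Pi>" "r \<in> ?\<Pi>" for p r
    unfolding Aeq using that by (intro sets.Int measurable_sets[OF P] measurable_sets[OF R]) auto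
  have probP: "prob (P -` {p} \<inter> space M) = 1 / fact n" if p: "p \<in> ?\<Pi>" for p
  proof -
    have "prob (P -` {p} \<inter> space M) = measure (distr M (perm_space n) P) {p}"
      using p by (subst measure_distr[OF P]) auto
    also have "\<dots> = measure (uniform_count_measure ?\<Pi>) {p}"
      using U by (simp add: uniform_indep_perms_def)
    also have "\<dots> = 1 / fact n"
      using p fin by (subst measure_uniform_count_measure) (auto simp: cardP[unfolded One_nat_def])
    finally show ?thesis .
  qed
  have probA: "prob (A p r) = 1 / fact n * q r" if "p \<in> ?\<Pi>" "r \<in> ?\<Pi>" for p r
    unfolding A_def q_def using that by (subst indep_varD[OF iv]) (auto simp: probP)
  have sumq: "(\<Sum>r\<in>?\<Pi>. q r) = 1"
  proof -
    interpret D: prob_space "distr M (perm_space n) R" by (rule prob_space_distr[OF R])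
    have "(\<Sum>r\<in>?\<Pi>. q r) = (\<Sum>r\<in>?\<Pi>. measure (distr M (perm_space n) R) {r})"
      unfolding q_def by (intro sum.cong refl) (subst measure_distr[OF R], auto)
    also have "\<dots> = measure (distr M (perm_space n) R) ?\<Pi>"
      by (rule D.finite_measure_eq_sum_singleton[symmetric, OF fin]) auto
    also have "\<dots> = 1" using D.prob_space by simp
    finally show ?thesis .
  qed
  have expand: "f (P \<omega>) (R \<omega>) = (\<Sum>p\<in>?\<Pi>. \<Sum>r\<in>?\<Pi>. f p r * indicat_real (A p r) \<omega>)" if w: "\<omega> \<in> space M" for \<omega>
  proof -
    have "(\<Sum>r\<in>?\<Pi>. f p r * indicat_real (A p r) \<omega>) = (if p = P \<omega> then f (P \<omega>) (R \<omega>) else 0)" for p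
    proof -
      have "(\<Sum>r\<in>?\<Pi>. f p r * indicat_real (A p r) \<omega>) = (\<Sum>r\<in>?\<Pi>. if r = R \<omega> then (if p = P \<omega> then f (P \<omega>) (R \<omega>) else 0) else 0)"
        using w by (intro sum.cong refl) (auto simp: A_def indicator_def)
      also have "\<dots> = (if p = P \<omega> then f (P \<omega>) (R \<omega>) else 0)"
        using fin Rsp[OF w] by (subst sum.delta) auto
      finally show ?thesis .
    qed
    then show ?thesis using fin Psp[OF w] by (simp add: sum.delta)
  qed
  have int: "integrable M (\<lambda>\<omega>. \<Sum>p\<in>?\<Pi>. \<Sum>r\<in>?\<Pi>. f p r * indicat_real (A p r) \<omega>)"
    by (intro Bochner_Integration.integrable_sum integrable_mult_right)
      (auto intro!: integrable_real_indicator A simp: emeasure_eq_measure)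
  show "integrable M (\<lambda>\<omega>. f (P \<omega>) (R \<omega>))"
    using int by (subst Bochner_Integration.integrable_cong[OF refl expand])
  have "integral\<^sup>L M (\<lambda>\<omega>. f (P \<omega>) (R \<omega>)) = integral\<^sup>L M (\<lambda>\<omega>. \<Sum>p\<in>?\<Pi>. \<Sum>r\<in>?\<Pi>. f p r * indicat_real (A p r) \<omega>)"
    by (rule Bochner_Integration.integral_cong[OF refl expand])
  also have "\<dots> = (\<Sum>p\<in>?\<Pi>. \<Sum>r\<in>?\<Pi>. f p r * prob (A p r))"
  proof -
    have i: "integrable M (\<lambda>\<omega>. f p r * indicat_real (A p r) \<omega>)" if "p \<in> ?\<Pi>" "r \<in> ?\<Pi>" for p r
      using A[OF that] by (intro integrable_mult_right integrable_real_indicator) (auto simp: emeasure_eq_measure)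
    have "integral\<^sup>L M (\<lambda>\<omega>. \<Sum>p\<in>?\<Pi>. \<Sum>r\<in>?\<Pi>. f p r * indicat_real (A p r) \<omega>) =
       (\<Sum>p\<in>?\<Pi>. integral\<^sup>L M (\<lambda>\<omega>. \<Sum>r\<in>?\<Pi>. f p r * indicat_real (A p r) \<omega>))"
      by (rule Bochner_Integration.integral_sum) (rule Bochner_Integration.integrable_sum, rule i)
    also have "\<dots> = (\<Sum>p\<in>?\<Pi>. \<Sum>r\<in>?\<Pi>. integral\<^sup>L M (\<lambda>\<omega>. f p r * indicat_real (A p r) \<omega>))"
      by (intro sum.cong refl Bochner_Integration.integral_sum i)
    also have "\<dots> = (\<Sum>p\<in>?\<Pi>. \<Sum>r\<in>?\<Pi>. f p r * prob (A p r))"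
    proof (intro sum.cong refl)
      fix p r assume "p \<in> ?\<Pi>" "r \<in> ?\<Pi>"
      then have "A p r \<inter> space M = A p r" using sets.sets_into_space[OF A] by blast
      then show "integral\<^sup>L M (\<lambda>\<omega>. f p r * indicat_real (A p r) \<omega>) = f p r * prob (A p r)"
        by simp
    qed
    finally show ?thesis .
  qed
  also have "\<dots> = (\<Sum>p\<in>?\<Pi>. \<Sum>r\<in>?\<Pi>. g (inv r \<circ> p) * (1 / fact n * q r))"
    by (intro sum.cong refl) (simp add: probA inv)
  also have "\<dots> = (\<Sum>r\<in>?\<Pi>. \<Sum>p\<in>?\<Pi>. g (inv r \<circ> p) * (1 / fact n * q r))"
    by (rule sum.swap)
  also have "\<dots> = (\<Sum>r\<in>?\<Pi>. (\<Sum>\<sigma>\<in>?\<Pi>. g \<sigma>) * (1 / fact n * q r))"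
  proof (intro sum.cong refl)
    fix r assume "r \<in> ?\<Pi>"
    then have "(\<Sum>\<sigma>\<in>?\<Pi>. g \<sigma>) = (\<Sum>p\<in>?\<Pi>. g (inv r \<circ> p))"
      by (intro setum_permutations_compose_left permutes_inv) simp
    then show "(\<Sum>p\<in>?\<Pi>. g (inv r \<circ> p) * (1 / fact n * q r)) = (\<Sum>\<sigma>\<in>?\<Pi>. g \<sigma>) * (1 / fact n * q r)"
      by (simp only: sum_distrib_right)
  qed
  also have "\<dots> = (\<Sum>\<sigma>\<in>?\<Pi>. g \<sigma>) * (1 / fact n) * (\<Sum>r\<in>?\<Pi>. q r)"
    by (simp add: sum_distrib_left mult.assoc)
  finally show "integral\<^sup>L M (\<lambda>\<omega>. f (P \<omega>) (R \<omega>)) = (\<Sum>\<sigma>\<in>?\<Pi>. g \<sigma>) / fact n"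
    by (simp add: sumq[unfolded One_nat_def])
qed

lemma choose_square_fact:
  "m \<le> n \<Longrightarrow> real (n choose m) ^ 2 * (fact (n - m) / fact n) = real (n choose m) / fact m"
  by (simp add: binomial_fact power2_eq_square)

text \<open>
  The second moment of the number of increasing sets of a uniform permutation.
\<close>
definition word_sum :: "nat \<Rightarrow> real" where
  "word_sum n = (\<Sum>m\<le>n. real (n choose m) / fact m * real (card (compatible_pairs m)))"

lemma mean_card_increasing_sets:
  "(\<Sum>\<sigma> | \<sigma> permutes {1..n}. real (card (increasing_sets n \<sigma>))) / fact n = laguerre_sum 1 n"
proof -
  have "(\<Sum>\<sigma> | \<sigma> permutes {1..n}. real (card (increasing_sets n \<sigma>))) =
      real (\<Sum>\<sigma> | \<sigma> permutes {1..n}. card (increasing_sets n \<sigma>))" by simp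
  also have "\<dots> / fact n = (\<Sum>k\<le>n. real (n choose k) ^ 2 * (fact (n - k) / fact n))"
    unfolding first_moment_increasing_sets by (simp add: sum_divide_distrib)
  also have "\<dots> = laguerre_sum 1 n"
    by (intro sum.cong refl) (subst choose_square_fact; simp)
  finally show ?thesis .
qed

lemma mean_square_card_increasing_sets:
  "(\<Sum>\<sigma> | \<sigma> permutes {1..n}. (real (card (increasing_sets n \<sigma>)))\<^sup>2) / fact n = word_sum n"
proof -
  have "(\<Sum>\<sigma> | \<sigma> permutes {1..n}. (real (card (increasing_sets n \<sigma>)))\<^sup>2) =
      real (\<Sum>\<sigma> | \<sigma> permutes {1..n}. (card (increasing_sets n \<sigma>))\<^sup>2)" by simp
  also have "\<dots> / fact n = (\<Sum>m\<le>n. (real (n choose m) ^ 2 * (fact (n - m) / fact n)) * real (card (compatible_pairs m)))"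
    unfolding second_moment_increasing_sets by (simp add: sum_divide_distrib)
  also have "\<dots> = word_sum n"
    unfolding word_sum_def by (intro sum.cong refl) (subst choose_square_fact; simp)
  finally show ?thesis .
qed

text \<open>
  Passing from \<open>V\<close> to \<open>V + 1\<close> shifts the mean by \<open>1\<close> and leaves the variance unchanged.
\<close>
lemma moments_V:
  assumes U: "uniform_indep_perms n M P R" and n: "n \<ge> 1"
  defines "X \<equiv> (\<lambda>\<omega>. real (V n (P \<omega>) (R \<omega>)))"
  shows "integrable M X"
    and "prob_space.expectation M X = laguerre_sum 1 n - 1"
    and "prob_space.variance M X = word_sum n - (laguerre_sum 1 n)\<^sup>2"
proof -
  let ?\<Pi> = "{p. p permutes {1..n}}" and ?Z = "\<lambda>\<sigma>. real (card (increasing_sets n \<sigma>))"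
  have fin: "finite ?\<Pi>" by (simp add: finite_permutations)
  have cardP: "card ?\<Pi> = fact n" by (rule card_permutations) auto
  have V: "real (V n p r) = ?Z (inv r \<circ> p) - 1" if "p permutes {1..n}" "r permutes {1..n}" for p r
    using Suc_V_eq_card_increasing_sets[OF that] by linarith
  show "integrable M X"
    unfolding X_def
    by (rule uniform_indep_perms_expectation(1)[where g = "\<lambda>\<sigma>. ?Z \<sigma> - 1", OF U n]) (rule V)
  have E': "integral\<^sup>L M X = (\<Sum>\<sigma>\<in>?\<Pi>. ?Z \<sigma> - 1) / fact n"
    unfolding X_def
    by (rule uniform_indep_perms_expectation(2)[where g = "\<lambda>\<sigma>. ?Z \<sigma> - 1", OF U n]) (rule V)
  show E: "prob_space.expectation M X = laguerre_sum 1 n - 1"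
    unfolding E' mean_card_increasing_sets[symmetric]
    by (simp add: sum_subtractf cardP[unfolded One_nat_def] diff_divide_distrib)
  define \<mu> where "\<mu> = laguerre_sum 1 n"
  have "prob_space.variance M X = (\<Sum>\<sigma>\<in>?\<Pi>. (?Z \<sigma> - \<mu>)\<^sup>2) / fact n"
    unfolding E unfolding X_def
    by (rule uniform_indep_perms_expectation(2)[OF U n]) (simp add: V \<mu>_def)
  also have "(\<Sum>\<sigma>\<in>?\<Pi>. (?Z \<sigma> - \<mu>)\<^sup>2) = (\<Sum>\<sigma>\<in>?\<Pi>. (?Z \<sigma>)\<^sup>2) - 2 * \<mu> * (\<Sum>\<sigma>\<in>?\<Pi>. ?Z \<sigma>) + fact n * \<mu>\<^sup>2"
    by (simp add: power2_diff sum.distrib sum_subtractf sum_distrib_left cardP[unfolded One_nat_def] algebra_simps)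
  also have "\<dots> / fact n = word_sum n - 2 * \<mu> * \<mu> + \<mu>\<^sup>2"
  proof -
    have "(s2 - 2 * \<mu> * s1 + fact n * \<mu>\<^sup>2) / fact n = s2 / fact n - 2 * \<mu> * (s1 / fact n) + \<mu>\<^sup>2" for s1 s2 :: real
      by (simp add: add_divide_distrib diff_divide_distrib)
    then show ?thesis
      by (simp only: mean_card_increasing_sets mean_square_card_increasing_sets \<mu>_def)
  qed
  finally show "prob_space.variance M X = word_sum n - (laguerre_sum 1 n)\<^sup>2"
    by (simp add: \<mu>_def power2_eq_square)
qed

lemma compatible_pairs_renewal_real:
  "real (card (compatible_pairs m)) = real ((2 * m) choose m) +
     (\<Sum>s<m. real ((2 * s) choose s) * real (card (compatible_pairs (m - 1 - s))))"
  by (subst compatible_pairs_renewal) simp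

lemma word_sum_eq:
  "word_sum n = (\<Sum>(k, l)\<in>{(k, l). k + l \<le> n}.
             4 ^ l * (1 / fact (k + l)) * real (n choose (k + l)) *
             (((real k + 1) / 2 + real l - 1) gchoose l))"
proof -
  define f where "f = (\<lambda>m l. real (n choose m) / fact m * (4 ^ l * (((real (m - l) + 1) / 2 + real l - 1) gchoose l)))"
  have "word_sum n = (\<Sum>m\<le>n. \<Sum>l\<le>m. f m l)"
    unfolding word_sum_def f_def sum_distrib_left[symmetric]
    by (intro sum.cong refl arg_cong2[where f = "(*)"] renewal_explicit compatible_pairs_renewal_real)
  also have "\<dots> = (\<Sum>(m, l)\<in>(SIGMA m:{..n}. {..m}). f m l)"
    by (rule sum.Sigma) auto
  also have "\<dots> = (\<Sum>(k, l)\<in>{(k, l). k + l \<le> n}. f (k + l) l)"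
    by (rule sum.reindex_bij_witness[of _ "\<lambda>(k, l). (k + l, l)" "\<lambda>(m, l). (m - l, l)"]) auto
  also have "\<dots> = (\<Sum>(k, l)\<in>{(k, l). k + l \<le> n}.
             4 ^ l * (1 / fact (k + l)) * real (n choose (k + l)) *
             (((real k + 1) / 2 + real l - 1) gchoose l))"
    by (intro sum.cong refl) (auto simp: f_def)
  finally show ?thesis .
qed

section \<open>Growth of the second moment\<close>

text \<open>
  A weighted average of a convergent sequence converges to the same limit if every single index
  loses its share of the total weight.
\<close>
lemma toeplitz_limit:
  fixes w :: "nat \<Rightarrow> nat \<Rightarrow> real"
  assumes w: "\<And>n m. w n m \<ge> 0" and W: "\<And>n. (\<Sum>m\<le>n. w n m) > 0"
    and neg: "\<And>m. (\<lambda>n. w n m / (\<Sum>m\<le>n. w n m)) \<longlonglongrightarrow> 0"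
    and a: "a \<longlonglongrightarrow> (c::real)"
  shows "(\<lambda>n. (\<Sum>m\<le>n. w n m * a m) / (\<Sum>m\<le>n. w n m)) \<longlonglongrightarrow> c"
proof -
  define W where "W = (\<lambda>n. \<Sum>m\<le>n. w n m)"
  have W0: "W n > 0" for n unfolding W_def by (rule assms)
  have "(\<lambda>n. (\<Sum>m\<le>n. w n m * a m) / W n - c) \<longlonglongrightarrow> 0"
    unfolding tendsto_iff
  proof (intro allI impI)
    fix e :: real assume e: "e > 0"
    from a have "\<forall>\<^sub>F m in sequentially. dist (a m) c < e / 2" using half_gt_zero[OF e] unfolding tendsto_iff by blast
    then obtain M where M: "\<And>m. m \<ge> M \<Longrightarrow> \<bar>a m - c\<bar> < e / 2"
      by (auto simp: eventually_sequentially dist_real_def)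
    have "(\<lambda>n. \<Sum>m<M. \<bar>a m - c\<bar> * (w n m / W n)) \<longlonglongrightarrow> (\<Sum>m<M. \<bar>a m - c\<bar> * 0)"
      unfolding W_def by (intro tendsto_intros neg)
    then have "\<forall>\<^sub>F n in sequentially. (\<Sum>m<M. \<bar>a m - c\<bar> * (w n m / W n)) < e / 2"
      using e by (intro order_tendstoD) auto
    then show "\<forall>\<^sub>F n in sequentially. dist ((\<Sum>m\<le>n. w n m * a m) / W n - c) 0 < e"
      using eventually_ge_at_top[of M]
    proof eventually_elim
      case (elim n)
      have "(\<Sum>m\<le>n. w n m * a m) / W n - c = (\<Sum>m\<le>n. (w n m / W n) * (a m - c))"
      proof -
        have "(\<Sum>m\<le>n. (w n m / W n) * (a m - c)) = (\<Sum>m\<le>n. w n m * a m) / W n - (\<Sum>m\<le>n. w n m) * c / W n"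
          unfolding W_def
          by (simp add: right_diff_distrib sum_subtractf sum_divide_distrib sum_distrib_right diff_divide_distrib)
        then show ?thesis using W0[of n] by (simp add: W_def)
      qed
      also have "\<bar>\<dots>\<bar> \<le> (\<Sum>m\<le>n. (w n m / W n) * \<bar>a m - c\<bar>)"
        by (rule order_trans[OF sum_abs]) (use w W0[of n] in \<open>auto simp: abs_mult\<close>)
      also have "\<dots> \<le> (\<Sum>m\<le>n. (if m < M then (w n m / W n) * \<bar>a m - c\<bar> else 0) + (w n m / W n) * (e / 2))"
      proof (rule sum_mono)
        fix m assume "m \<in> {..n}"
        have q: "w n m / W n \<ge> 0" using w W0[of n] by simp
        show "w n m / W n * \<bar>a m - c\<bar> \<le> (if m < M then w n m / W n * \<bar>a m - c\<bar> else 0) + w n m / W n * (e / 2)"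
        proof (cases "m < M")
          case True
          moreover have "0 \<le> w n m / W n * (e / 2)" using q e by (intro mult_nonneg_nonneg) auto
          ultimately show ?thesis by simp
        next
          case False
          then show ?thesis using mult_left_mono[OF less_imp_le[OF M] q, of m] by simp
        qed
      qed
      also have "\<dots> = (\<Sum>m<M. \<bar>a m - c\<bar> * (w n m / W n)) + (W n / W n) * (e / 2)"
      proof -
        have "{..n} \<inter> {m. m < M} = {..<M}" using elim by auto
        moreover have "(\<Sum>m\<le>n. w n m / W n * (e / 2)) = W n / W n * (e / 2)"
          by (simp only: W_def sum_divide_distrib[symmetric] sum_distrib_right[symmetric])
        ultimately show ?thesis
          by (simp add: sum.distrib sum.If_cases mult.commute)
      qed
      finally show ?case using elim W0[of n] by (simp add: dist_real_def)
    qed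
  qed
  then show ?thesis unfolding W_def by (simp add: LIM_zero_iff)
qed

text \<open>
  The term of index \<open>m\<close> is already negligible against that of index \<open>m + 1\<close>, whose ratio to it grows
  linearly in \<open>n\<close>.
\<close>
lemma laguerre_weight_negligible:
  fixes x :: real
  assumes x: "x > 0"
  shows "(\<lambda>n. (real (n choose m) * x ^ m / fact m) / laguerre_sum x n) \<longlonglongrightarrow> 0"
proof (rule tendsto_sandwich)
  show "\<forall>\<^sub>F n in sequentially. 0 \<le> (real (n choose m) * x ^ m / fact m) / laguerre_sum x n"
    using x by (intro always_eventually allI divide_nonneg_nonneg sum_nonneg) auto
  show "(\<lambda>n. (real m + 1)\<^sup>2 / (x * (real n - real m))) \<longlonglongrightarrow> 0"
    using x by real_asymp
  show "\<forall>\<^sub>F n in sequentially. (real (n choose m) * x ^ m / fact m) / laguerre_sum x n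
      \<le> (real m + 1)\<^sup>2 / (x * (real n - real m))"
    using eventually_gt_at_top[of m]
  proof eventually_elim
    case (elim n)
    define w where "w = (\<lambda>k. real (n choose k) * x ^ k / fact k)"
    have w0: "w (Suc m) > 0" unfolding w_def using elim x by simp
    have le: "w (Suc m) \<le> (\<Sum>k\<le>n. w k)"
      by (rule member_le_sum) (use elim x in \<open>auto simp: w_def\<close>)
    have "real (n choose m) * real (n - m) = real (n choose Suc m) * real (Suc m)"
      by (metis binomial_absorb_comp binomial_absorption mult.commute of_nat_mult)
    then have 1: "real (n choose m) * (real n - real m) = real (n choose Suc m) * (real m + 1)"
      using elim by (simp add: of_nat_diff add.commute)
    have "w m * (x * (real n - real m)) = (real m + 1)\<^sup>2 * w (Suc m)"
    proof -
      have "w m * (x * (real n - real m)) = (real (n choose m) * (real n - real m)) * x ^ Suc m / fact m"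
        by (simp add: w_def)
      also have "\<dots> = (real m + 1)\<^sup>2 * w (Suc m)"
        unfolding 1 w_def by (simp add: fact_Suc power2_eq_square divide_simps)
      finally show ?thesis .
    qed
    then have "w m / w (Suc m) = (real m + 1)\<^sup>2 / (x * (real n - real m))"
      using w0 elim x by (simp add: divide_simps)
    moreover have "w m / (\<Sum>k\<le>n. w k) \<le> w m / w (Suc m)"
    proof (rule divide_left_mono[OF le])
      show "w m \<ge> 0" using x by (simp add: w_def)
      show "0 < (\<Sum>k\<le>n. w k) * w (Suc m)" using w0 le by simp
    qed
    ultimately show ?case unfolding w_def by simp
  qed
qed simp

lemma word_sum_asymp: "\<exists>c>0. word_sum \<sim>[at_top] (\<lambda>n. c * laguerre_sum (2 + sqrt 5) n)"
proof -
  define L where "L = 2 + sqrt (5 :: real)"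
  have L: "L > 0" by (simp add: L_def add_pos_nonneg)
  obtain c where c: "c > 0" "(\<lambda>m. real (card (compatible_pairs m)) / L ^ m) \<longlonglongrightarrow> c"
    using renewal_growth[OF compatible_pairs_renewal_real] unfolding L_def by blast
  define w where "w = (\<lambda>n m. real (n choose m) * L ^ m / fact m)"
  have "(\<lambda>n. (\<Sum>m\<le>n. w n m * (real (card (compatible_pairs m)) / L ^ m)) / (\<Sum>m\<le>n. w n m)) \<longlonglongrightarrow> c"
  proof (rule toeplitz_limit[OF _ _ _ c(2)])
    show "w n m \<ge> 0" for n m using L by (simp add: w_def)
    show "(\<Sum>m\<le>n. w n m) > 0" for n
      by (rule sum_pos) (use L in \<open>auto simp: w_def\<close>)
    show "(\<lambda>n. w n m / (\<Sum>m\<le>n. w n m)) \<longlonglongrightarrow> 0" for m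
      unfolding w_def by (rule laguerre_weight_negligible[OF L])
  qed
  moreover have "(\<Sum>m\<le>n. w n m * (real (card (compatible_pairs m)) / L ^ m)) = word_sum n" for n
    unfolding word_sum_def by (intro sum.cong refl) (use L in \<open>simp add: w_def\<close>)
  ultimately have "(\<lambda>n. word_sum n / laguerre_sum L n) \<longlonglongrightarrow> c"
    by (simp add: w_def)
  then have "(\<lambda>n. word_sum n / laguerre_sum L n / c) \<longlonglongrightarrow> c / c"
    by (intro tendsto_intros) (use c in auto)
  then have "(\<lambda>n. word_sum n / (c * laguerre_sum L n)) \<longlonglongrightarrow> 1"
    using c by (simp add: mult.commute)
  then show ?thesis using c(1) unfolding L_def by (intro exI[of _ c] conjI asymp_equivI')
qed

lemma laguerre_asymp_powr:
  assumes x: "x > 0"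
  shows "laguerre_sum x \<sim>[at_top]
    (\<lambda>n. exp (- x / 2) / (2 * sqrt pi * x powr (1 / 4)) / real n powr (1 / 4) * exp (2 * sqrt x * sqrt (real n)))"
proof -
  have "\<forall>\<^sub>F n in at_top. exp (- x / 2) / (2 * sqrt pi) * (exp (2 * sqrt (x * real n)) / sqrt (sqrt (x * real n)))
     = exp (- x / 2) / (2 * sqrt pi * x powr (1 / 4)) / real n powr (1 / 4) * exp (2 * sqrt x * sqrt (real n))"
    using eventually_gt_at_top[of 0]
  proof eventually_elim
    case (elim n)
    have q: "sqrt (sqrt y) = y powr (1 / 4)" if "y > 0" for y :: real
      using that by (simp add: powr_half_sqrt[symmetric] powr_powr)
    show ?case using x elim by (simp add: q powr_mult real_sqrt_mult mult.assoc)
  qed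
  then show ?thesis
    using asymp_equiv_transfer[OF laguerre_asymp[OF x] always_eventually] by simp
qed

text \<open>
  The exponential rates are \<open>4\<close> and \<open>2 sqrt (2 + sqrt 5) \<ge> 4\<close>. Already the powers of \<open>n\<close>, namely
  \<open>n powr (- 1 / 2)\<close> against \<open>n powr (- 1 / 4)\<close>, make the quotient tend to \<open>0\<close>.
\<close>
lemma square_laguerre_negligible:
  assumes c: "c > 0" and T: "T \<sim>[at_top] (\<lambda>n. c * laguerre_sum (2 + sqrt 5) n)"
  shows "(\<lambda>n. (laguerre_sum 1 n)\<^sup>2 / T n) \<longlonglongrightarrow> 0"
proof -
  define L where "L = 2 + sqrt (5 :: real)"
  have s5: "2 < sqrt (5::real)" by (rule real_less_rsqrt) simp
  have L: "L > 0" by (simp add: L_def add_pos_nonneg)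
  \<comment> \<open>Here \<open>2 + sqrt 5 \<ge> 4\<close> enters: the squared mean does not outgrow the second moment.\<close>
  have sL: "2 \<le> sqrt L" using s5 by (intro real_le_rsqrt) (simp add: L_def)
  define a where "a = exp (- 1 / 2) / (2 * sqrt pi)"
  define b where "b = exp (- L / 2) / (2 * sqrt pi * L powr (1 / 4))"
  have b: "b > 0" using L by (simp add: b_def)
  have 1: "laguerre_sum 1 \<sim>[at_top] (\<lambda>n. a / real n powr (1 / 4) * exp (2 * sqrt (real n)))"
    using laguerre_asymp_powr[of 1] by (simp add: a_def)
  have 2: "T \<sim>[at_top] (\<lambda>n. c * (b / real n powr (1 / 4) * exp (2 * sqrt L * sqrt (real n))))"
    using asymp_equiv_trans[OF T[folded L_def]
        asymp_equiv_mult[OF asymp_equiv_refl laguerre_asymp_powr[OF L, folded b_def]]] .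
  have "(\<lambda>n. (laguerre_sum 1 n)\<^sup>2 / T n) \<sim>[at_top]
     (\<lambda>n. (a / real n powr (1 / 4) * exp (2 * sqrt (real n)))\<^sup>2 / (c * (b / real n powr (1 / 4) * exp (2 * sqrt L * sqrt (real n)))))"
    by (intro asymp_equiv_divide asymp_equiv_power 1 2)
  moreover have "(\<lambda>n. (a / real n powr (1 / 4) * exp (2 * sqrt (real n)))\<^sup>2 / (c * (b / real n powr (1 / 4) * exp (2 * sqrt L * sqrt (real n))))) \<longlonglongrightarrow> 0"
  proof (rule Lim_null_comparison)
    show "(\<lambda>n. a\<^sup>2 / (c * b) / real n powr (1 / 4)) \<longlonglongrightarrow> 0" by real_asymp
    show "\<forall>\<^sub>F n in at_top. norm ((a / real n powr (1 / 4) * exp (2 * sqrt (real n)))\<^sup>2 / (c * (b / real n powr (1 / 4) * exp (2 * sqrt L * sqrt (real n)))))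
       \<le> a\<^sup>2 / (c * b) / real n powr (1 / 4)"
      using eventually_gt_at_top[of 0]
    proof eventually_elim
      case (elim n)
      define r where "r = real n powr (1 / 4)"
      have r: "r > 0" using elim by (simp add: r_def)
      have "(exp (2 * sqrt (real n)))\<^sup>2 \<le> exp (2 * sqrt L * sqrt (real n))"
        using sL mult_right_mono[OF sL, of "sqrt (real n)"] by (simp flip: exp_of_nat_mult exp_double)
      then have e: "(exp (2 * sqrt (real n)))\<^sup>2 / exp (2 * sqrt L * sqrt (real n)) \<le> 1" by simp
      let ?q = "(a / r * exp (2 * sqrt (real n)))\<^sup>2 / (c * (b / r * exp (2 * sqrt L * sqrt (real n))))"
      have q: "?q = a\<^sup>2 / (c * b) / r * ((exp (2 * sqrt (real n)))\<^sup>2 / exp (2 * sqrt L * sqrt (real n)))"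
        using r by (simp add: power_mult_distrib power_divide power2_eq_square mult_ac)
      also have "\<dots> \<le> a\<^sup>2 / (c * b) / r * 1"
        using r b c by (intro mult_left_mono e) auto
      finally have le: "?q \<le> a\<^sup>2 / (c * b) / r" by simp
      have ge: "?q \<ge> 0" unfolding q using r b c by auto
      show ?case unfolding r_def[symmetric] real_norm_def abs_of_nonneg[OF ge] by (rule le)
    qed
  qed
  ultimately show ?thesis by (simp add: tendsto_asymp_equiv_cong)
qed

section \<open>The limit theorem\<close>

text \<open>
  Since \<open>X\<close> is nonnegative, \<open>\<bar>X - E X\<bar> \<le> X + E X\<close>, a variable of mean \<open>2 E X\<close>. This beats
  Chebyshev's inequality, which bounds the probability only by \<open>1 / \<epsilon>\<^sup>2\<close> when \<open>s\<close> is the standard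
  deviation, as soon as the mean is small compared with \<open>s\<close>.
\<close>
lemma Markov_deviation:
  assumes "prob_space M" "integrable M X" "\<And>\<omega>. X \<omega> \<ge> (0 :: real)" "s > 0" "\<epsilon> > 0"
  shows "measure M {\<omega> \<in> space M. \<bar>(X \<omega> - integral\<^sup>L M X) / s\<bar> > \<epsilon>} \<le> 2 * integral\<^sup>L M X / (\<epsilon> * s)"
proof -
  interpret prob_space M by fact
  define E where "E = integral\<^sup>L M X"
  have E: "E \<ge> 0" unfolding E_def using assms(3) by simp
  have int: "integrable M (\<lambda>\<omega>. X \<omega> + E)" using assms(2) by simp
  have [measurable]: "X \<in> borel_measurable M" using assms(2) by simp
  have "prob {\<omega> \<in> space M. \<bar>(X \<omega> - E) / s\<bar> > \<epsilon>} \<le> prob {\<omega> \<in> space M. X \<omega> + E \<ge> \<epsilon> * s}"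
  proof (rule finite_measure_mono)
    show "{\<omega> \<in> space M. X \<omega> + E \<ge> \<epsilon> * s} \<in> events" by measurable
    show "{\<omega> \<in> space M. \<bar>(X \<omega> - E) / s\<bar> > \<epsilon>} \<subseteq> {\<omega> \<in> space M. X \<omega> + E \<ge> \<epsilon> * s}"
    proof safe
      fix \<omega> assume "\<omega> \<in> space M" "\<epsilon> < \<bar>(X \<omega> - E) / s\<bar>"
      then have "\<epsilon> * s < \<bar>X \<omega> - E\<bar>" using assms(4) by (simp add: pos_less_divide_eq)
      then show "\<epsilon> * s \<le> X \<omega> + E" using assms(3)[of \<omega>] E by linarith
    qed
  qed
  also have "\<dots> \<le> (\<integral>\<omega>. X \<omega> + E \<partial>M) / (\<epsilon> * s)"
    by (rule integral_Markov_inequality_measure[where A = "space M"]) (use int assms E in auto)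
  also have "(\<integral>\<omega>. X \<omega> + E \<partial>M) = 2 * E"
    using assms(2) by (simp add: E_def prob_space)
  finally show ?thesis unfolding E_def .
qed

theorem theorem8p1:
  shows "\<exists>C>0. \<forall>(M :: nat \<Rightarrow> 'a measure) (P :: nat \<Rightarrow> 'a \<Rightarrow> nat \<Rightarrow> nat) (R :: nat \<Rightarrow> 'a \<Rightarrow> nat \<Rightarrow> nat).
    (\<forall>n\<ge>1. uniform_indep_perms n (M n) (P n) (R n)) \<longrightarrow>
    (let X = (\<lambda>n \<omega>. real (V n (P n \<omega>) (R n \<omega>)));
         E = (\<lambda>n. prob_space.expectation (M n) (X n));
         Var = (\<lambda>n. prob_space.variance (M n) (X n))
     in
       (\<forall>n\<ge>1. E n = (\<Sum>k = 1..n. real (n choose k) ^ 2 * (fact (n - k) / fact n))) \<and>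
       E \<sim>[at_top] (\<lambda>n. 1 / (2 * sqrt (pi * exp 1) * real n powr (1 / 4)) * exp (2 * sqrt (real n))) \<and>
       (\<forall>n\<ge>1. Var n =
          (\<Sum>(k, l)\<in>{(k, l). k + l \<le> n}.
             4 ^ l * (1 / fact (k + l)) * real (n choose (k + l)) *
             (((real k + 1) / 2 + real l - 1) gchoose l)) -
          (\<Sum>k = 0..n. real (n choose k) ^ 2 * (fact (n - k) / fact n))\<^sup>2) \<and>
       Var \<sim>[at_top] (\<lambda>n. C / real n powr (1 / 4) * exp (2 * sqrt (2 + sqrt 5) * sqrt (real n))) \<and>
       tendsto_zero_in_probability M (\<lambda>n \<omega>. (X n \<omega> - E n) / sqrt (Var n)))"
proof -
  define L where "L = 2 + sqrt (5 :: real)"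
  have L: "L > 0" by (simp add: L_def add_pos_nonneg)
  obtain c where c: "c > 0" and T: "word_sum \<sim>[at_top] (\<lambda>n. c * laguerre_sum L n)"
    using word_sum_asymp unfolding L_def by blast
  define b where "b = exp (- L / 2) / (2 * sqrt pi * L powr (1 / 4))"
  \<comment> \<open>The constant for the Laguerre sum at \<open>2 + sqrt 5\<close>, times the limit of \<open>N(m) / (2 + sqrt 5) ^ m\<close>.\<close>
  define C where "C = c * b"
  have C: "C > 0" using L c by (simp add: C_def b_def)
  define \<mu> where "\<mu> = laguerre_sum 1"
  have \<mu>1: "\<mu> n \<ge> 1" for n
    using member_le_sum[of 0 "{..n}" "\<lambda>k. real (n choose k) * 1 ^ k / fact k"] by (simp add: \<mu>_def)
  have \<mu>_sum0: "\<mu> n = (\<Sum>k = 0..n. real (n choose k) ^ 2 * (fact (n - k) / fact n))" for n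
    unfolding \<mu>_def atMost_atLeast0 by (intro sum.cong refl) (subst choose_square_fact; simp)
  have \<mu>_sum1: "\<mu> n - 1 = (\<Sum>k = 1..n. real (n choose k) ^ 2 * (fact (n - k) / fact n))" for n
    unfolding \<mu>_sum0 by (subst sum.atLeast_Suc_atMost) auto
  have \<mu>_asymp: "\<mu> \<sim>[at_top] (\<lambda>n. 1 / (2 * sqrt (pi * exp 1) * real n powr (1 / 4)) * exp (2 * sqrt (real n)))"
  proof -
    have "sqrt (exp 1) = exp (1 / 2 :: real)"
      by (rule real_sqrt_unique) (auto simp: power2_eq_square simp flip: exp_add)
    then have "exp (- 1 / 2) / (2 * sqrt pi) = 1 / (2 * sqrt (pi * exp 1))"
      by (simp add: real_sqrt_mult exp_minus field_simps)
    then have "exp (- 1 / 2) / (2 * sqrt pi * 1 powr (1 / 4)) / y * z = 1 / (2 * sqrt (pi * exp 1) * y) * z" for y z :: real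
      by (metis divide_divide_eq_left mult.right_neutral powr_one_eq_one)
    then show ?thesis using laguerre_asymp_powr[of 1] unfolding \<mu>_def by simp
  qed
  have \<mu>_top: "filterlim \<mu> at_top at_top"
  proof -
    have "filterlim (\<lambda>n. 1 / (2 * sqrt (pi * exp 1) * real n powr (1 / 4)) * exp (2 * sqrt (real n))) at_top at_top"
    proof -
      have "0 < 1 / (2 * sqrt (pi * exp 1))" by simp
      moreover have "filterlim (\<lambda>n. k / real n powr (1 / 4) * exp (2 * sqrt (real n))) at_top at_top" if "k > 0" for k :: real
        using that by real_asymp
      ultimately show ?thesis by (simp only: divide_divide_eq_left[symmetric])
    qed
    then show ?thesis using asymp_equiv_at_top_transfer[OF asymp_equiv_symI[OF \<mu>_asymp]] by blast
  qed
  have E_asymp: "(\<lambda>n. \<mu> n - 1) \<sim>[at_top] \<mu>"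
  proof (rule asymp_equivI')
    have "(\<lambda>n. 1 - 1 / \<mu> n) \<longlonglongrightarrow> 1 - 0"
      by (intro tendsto_diff tendsto_const tendsto_divide_0[OF tendsto_const] filterlim_at_top_imp_at_infinity \<mu>_top)
    moreover have "1 - 1 / \<mu> n = (\<mu> n - 1) / \<mu> n" for n using \<mu>1[of n] by (simp add: field_simps)
    ultimately show "(\<lambda>n. (\<mu> n - 1) / \<mu> n) \<longlonglongrightarrow> 1" by simp
  qed
  have T_pos: "word_sum n > 0" for n
  proof -
    have "card (compatible_pairs m) > 0" for m
      by (subst compatible_pairs_renewal) (simp add: zero_less_binomial)
    then show ?thesis unfolding word_sum_def by (intro sum_pos) auto
  qed
  have neg: "(\<lambda>n. (\<mu> n)\<^sup>2 / word_sum n) \<longlonglongrightarrow> 0"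
    unfolding \<mu>_def by (rule square_laguerre_negligible[OF c T[unfolded L_def]])
  define v where "v = (\<lambda>n. word_sum n - (\<mu> n)\<^sup>2)"
  have v_asymp: "v \<sim>[at_top] word_sum"
  proof (rule asymp_equivI')
    have "(\<lambda>n. 1 - (\<mu> n)\<^sup>2 / word_sum n) \<longlonglongrightarrow> 1 - 0"
      by (intro tendsto_diff tendsto_const neg)
    moreover have "1 - (\<mu> n)\<^sup>2 / word_sum n = v n / word_sum n" for n
      using T_pos[of n] by (simp add: v_def field_simps)
    ultimately show "(\<lambda>n. v n / word_sum n) \<longlonglongrightarrow> 1" by simp
  qed
  have v_asymp': "v \<sim>[at_top] (\<lambda>n. C / real n powr (1 / 4) * exp (2 * sqrt L * sqrt (real n)))"
  proof -
    have "(\<lambda>n. c * laguerre_sum L n) \<sim>[at_top] (\<lambda>n. c * (b / real n powr (1 / 4) * exp (2 * sqrt L * sqrt (real n))))"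
      by (rule asymp_equiv_mult[OF asymp_equiv_refl laguerre_asymp_powr[OF L, folded b_def]])
    then have "v \<sim>[at_top] (\<lambda>n. c * (b / real n powr (1 / 4) * exp (2 * sqrt L * sqrt (real n))))"
      by (intro asymp_equiv_trans[OF v_asymp asymp_equiv_trans[OF T]])
    then show ?thesis by (simp add: C_def mult_ac)
  qed
  have ratio: "(\<lambda>n. \<mu> n / sqrt (v n)) \<longlonglongrightarrow> 0"
  proof -
    have "(\<lambda>n. (\<mu> n)\<^sup>2 / v n) \<sim>[at_top] (\<lambda>n. (\<mu> n)\<^sup>2 / word_sum n)"
      by (intro asymp_equiv_divide asymp_equiv_refl v_asymp)
    then have "(\<lambda>n. (\<mu> n)\<^sup>2 / v n) \<longlonglongrightarrow> 0"
      using tendsto_asymp_equiv_cong neg by blast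
    then have "(\<lambda>n. sqrt ((\<mu> n)\<^sup>2 / v n)) \<longlonglongrightarrow> sqrt 0" by (rule tendsto_real_sqrt)
    moreover have "sqrt ((\<mu> n)\<^sup>2 / v n) = \<mu> n / sqrt (v n)" for n
      using \<mu>1[of n] by (simp add: real_sqrt_divide)
    ultimately show ?thesis by simp
  qed
  have v_pos: "\<forall>\<^sub>F n in at_top. v n > 0"
  proof -
    have "\<forall>\<^sub>F n in at_top. (\<mu> n)\<^sup>2 / word_sum n < 1" using neg by (rule order_tendstoD) simp
    then show ?thesis
    proof eventually_elim
      case (elim n)
      then show ?case using T_pos[of n] by (simp add: v_def)
    qed
  qed
  show ?thesis
  proof (intro exI[of _ C] conjI C allI impI)
    fix M :: "nat \<Rightarrow> 'a measure" and P R :: "nat \<Rightarrow> 'a \<Rightarrow> nat \<Rightarrow> nat"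
    assume U: "\<forall>n\<ge>1. uniform_indep_perms n (M n) (P n) (R n)"
    define X where "X = (\<lambda>n \<omega>. real (V n (P n \<omega>) (R n \<omega>)))"
    define E where "E = (\<lambda>n. prob_space.expectation (M n) (X n))"
    define Var where "Var = (\<lambda>n. prob_space.variance (M n) (X n))"
    have int: "integrable (M n) (X n)" and E: "E n = \<mu> n - 1" and Var: "Var n = v n" if "n \<ge> 1" for n
      using moments_V[OF U[rule_format, OF that] that] by (simp_all add: X_def E_def Var_def \<mu>_def v_def)
    have evE: "\<forall>\<^sub>F n in at_top. E n = \<mu> n - 1" and evVar: "\<forall>\<^sub>F n in at_top. Var n = v n"
      by (rule eventually_mono[OF eventually_ge_at_top[of 1]], erule E Var)+
    have E_lim: "E \<sim>[at_top] (\<lambda>n. 1 / (2 * sqrt (pi * exp 1) * real n powr (1 / 4)) * exp (2 * sqrt (real n)))"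
      using asymp_equiv_cong[OF evE always_eventually] asymp_equiv_trans[OF E_asymp \<mu>_asymp] by blast
    have Var_lim: "Var \<sim>[at_top] (\<lambda>n. C / real n powr (1 / 4) * exp (2 * sqrt (2 + sqrt 5) * sqrt (real n)))"
      using asymp_equiv_cong[OF evVar always_eventually] v_asymp'[unfolded L_def] by blast
    have prob: "tendsto_zero_in_probability M (\<lambda>n \<omega>. (X n \<omega> - E n) / sqrt (Var n))"
      unfolding tendsto_zero_in_probability_def
    proof (intro allI impI)
      fix \<epsilon> :: real assume \<epsilon>: "\<epsilon> > 0"
      show "(\<lambda>n. measure (M n) {\<omega> \<in> space (M n). \<epsilon> < \<bar>(X n \<omega> - E n) / sqrt (Var n)\<bar>}) \<longlonglongrightarrow> 0"
      proof (rule Lim_null_comparison)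
        show "(\<lambda>n. 2 / \<epsilon> * (\<mu> n / sqrt (v n))) \<longlonglongrightarrow> 0"
          by (rule tendsto_mult_right_zero[OF ratio])
        show "\<forall>\<^sub>F n in at_top. norm (measure (M n) {\<omega> \<in> space (M n). \<epsilon> < \<bar>(X n \<omega> - E n) / sqrt (Var n)\<bar>})
            \<le> 2 / \<epsilon> * (\<mu> n / sqrt (v n))"
          using v_pos eventually_ge_at_top[of 1]
        proof eventually_elim
          case (elim n)
          have ps: "prob_space (M n)" using U elim(2) by (simp add: uniform_indep_perms_def)
          have "measure (M n) {\<omega> \<in> space (M n). \<epsilon> < \<bar>(X n \<omega> - E n) / sqrt (Var n)\<bar>}
              \<le> 2 * E n / (\<epsilon> * sqrt (Var n))"
            using Markov_deviation[OF ps int[OF elim(2)] _ _ \<epsilon>, of "sqrt (Var n)"] elim(1)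
            by (simp add: E_def[symmetric] Var[OF elim(2)]) (simp add: X_def E_def)
          also have "\<dots> = 2 / \<epsilon> * (E n / sqrt (v n))" by (simp add: Var[OF elim(2)])
          also have "\<dots> \<le> 2 / \<epsilon> * (\<mu> n / sqrt (v n))"
            using \<epsilon> elim(1) E[OF elim(2)] by (intro mult_left_mono divide_right_mono) auto
          finally show ?case by simp
        qed
      qed
    qed
    have "(\<forall>n\<ge>1. E n = (\<Sum>k = 1..n. real (n choose k) ^ 2 * (fact (n - k) / fact n))) \<and>
       E \<sim>[at_top] (\<lambda>n. 1 / (2 * sqrt (pi * exp 1) * real n powr (1 / 4)) * exp (2 * sqrt (real n))) \<and>
       (\<forall>n\<ge>1. Var n =
          (\<Sum>(k, l)\<in>{(k, l). k + l \<le> n}.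
             4 ^ l * (1 / fact (k + l)) * real (n choose (k + l)) *
             (((real k + 1) / 2 + real l - 1) gchoose l)) -
          (\<Sum>k = 0..n. real (n choose k) ^ 2 * (fact (n - k) / fact n))\<^sup>2) \<and>
       Var \<sim>[at_top] (\<lambda>n. C / real n powr (1 / 4) * exp (2 * sqrt (2 + sqrt 5) * sqrt (real n))) \<and>
       tendsto_zero_in_probability M (\<lambda>n \<omega>. (X n \<omega> - E n) / sqrt (Var n))"
    proof (intro conjI allI impI E_lim Var_lim prob)
      fix n :: nat assume n: "n \<ge> 1"
      show "E n = (\<Sum>k = 1..n. real (n choose k) ^ 2 * (fact (n - k) / fact n))"
        by (rule trans[OF E[OF n] \<mu>_sum1])
      show "Var n = (\<Sum>(k, l)\<in>{(k, l). k + l \<le> n}.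
             4 ^ l * (1 / fact (k + l)) * real (n choose (k + l)) *
             (((real k + 1) / 2 + real l - 1) gchoose l)) -
          (\<Sum>k = 0..n. real (n choose k) ^ 2 * (fact (n - k) / fact n))\<^sup>2"
        unfolding Var[OF n] v_def word_sum_eq \<mu>_sum0 by (rule refl)
    qed
    then show "let X = (\<lambda>n \<omega>. real (V n (P n \<omega>) (R n \<omega>)));
         E = (\<lambda>n. prob_space.expectation (M n) (X n));
         Var = (\<lambda>n. prob_space.variance (M n) (X n))
     in
       (\<forall>n\<ge>1. E n = (\<Sum>k = 1..n. real (n choose k) ^ 2 * (fact (n - k) / fact n))) \<and>
       E \<sim>[at_top] (\<lambda>n. 1 / (2 * sqrt (pi * exp 1) * real n powr (1 / 4)) * exp (2 * sqrt (real n))) \<and>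
       (\<forall>n\<ge>1. Var n =
          (\<Sum>(k, l)\<in>{(k, l). k + l \<le> n}.
             4 ^ l * (1 / fact (k + l)) * real (n choose (k + l)) *
             (((real k + 1) / 2 + real l - 1) gchoose l)) -
          (\<Sum>k = 0..n. real (n choose k) ^ 2 * (fact (n - k) / fact n))\<^sup>2) \<and>
       Var \<sim>[at_top] (\<lambda>n. C / real n powr (1 / 4) * exp (2 * sqrt (2 + sqrt 5) * sqrt (real n))) \<and>
       tendsto_zero_in_probability M (\<lambda>n \<omega>. (X n \<omega> - E n) / sqrt (Var n))"
      unfolding Let_def E_def Var_def X_def .
  qed
qed

end
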